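(* Let $p,q>0$ and let $X\in\mathfrak{su}(p,q)$ be a non-zero nilpotent element. Let $\mathbf{d}=[d_1^{t_{d_1}},\dots,d_s^{t_{d_s}}]\in\mathcal{P}(p+q)$ be the partition associated with the orbit of $X$, and let $\mathbb{E}_{\mathbf d}$ be the set of even parts $d_i$. Let $p_{d_i}$ (respectively $q_{d_i}$) be the number of $+1$ (respectively $-1$) occurring in the first column of the $t_{d_i}\times d_i$ block in the signed Young diagram of $X$. Then the following statements are equivalent: (1) $X$ is real in $\mathfrak{su}(p,q)$ (with respect to $\mathrm{SU}(p,q)$). (2) $X$ is strongly real in $\mathfrak{su}(p,q)$ (with respect to $\mathrm{SU}(p,q)$). (3) $p_\eta=q_\eta=t_\eta/2$ for all $\eta\in\mathbb{E}_{\mathbf d}$.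
   Context: For a Lie group $G$ with Lie algebra $\mathfrak{g}$, $X\in\mathfrak{g}$ is real ($\mathrm{Ad}_G$-real) if $-X=\mathrm{Ad}(g)X$ for some $g\in G$, and strongly real if $-X=\mathrm{Ad}(\tau)X$ for some $\tau\in G$ with $\tau^2=\mathrm{Id}$. Let $\mathrm{I}_{p,q}=\mathrm{diag}(\mathrm{I}_p,-\mathrm{I}_q)$ and $\langle x,y\rangle=\overline{x}^t\mathrm{I}_{p,q}y$ on $V=\mathbb{C}^{p+q}$. $\mathrm{SU}(p,q)=\{g\in\mathrm{SL}_{p+q}(\mathbb{C})\mid\overline{g}^t\mathrm{I}_{p,q}g=\mathrm{I}_{p,q}\}$, $\mathfrak{su}(p,q)=\{z\in\mathfrak{sl}_{p+q}(\mathbb{C})\mid\overline{z}^t\mathrm{I}_{p,q}+\mathrm{I}_{p,q}z=0\}$. $\mathcal{P}(m)$ is the set of partitions of $m$, written $[d_1^{t_{d_1}},\dots,d_s^{t_{d_s}}]$ with $d_1>\dots>d_s>0$, $t_{d_i}\geq 1$ and $\sum_i t_{d_i}d_i=m$. The partition $\mathbf d$ of $X$ is given by its Jordan block sizes ($t_d$ is the number of blocks of size $d$). Choose an $\mathfrak{sl}_2$-triple $\{X,H,Y\}\subset\mathfrak{su}(p,q)$ ($[H,X]=2X$, $[H,Y]=-2Y$, $[X,Y]=H$). Let $M(d-1)$ be the sum of all irreducible $\mathrm{Span}_{\mathbb{R}}\{X,H,Y\}$-submodules of $V$ of real dimension $d$, and $L(d-1)=\ker Y\cap M(d-1)$; then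 $t_d=\dim_{\mathbb{C}}L(d-1)$. For each part $d$, $L(d-1)$ has a $\mathbb{C}$-basis $v^d_1,\dots,v^d_{t_d}$ with $\langle v^d_j,X^{d-1}v^d_k\rangle=0$ for $j\ne k$, and $\langle v^d_j,X^{d-1}v^d_j\rangle=\pm1$ if $d$ is odd, $=\pm\sqrt{-1}$ if $d$ is even. Then $$p_d=\begin{cases}\#\{j\mid\langle v^d_j,X^{d-1}v^d_j\rangle=1\}& d\text{ odd},\\ \#\{j\mid\sqrt{-1}\,\langle v^d_j,X^{d-1}v^d_j\rangle=1\}& d\text{ even},\end{cases}\qquad q_d=t_d-p_d .$$ These numbers depend only on the $\mathrm{SU}(p,q)$-orbit of $X$. The signed Young diagram of $X$ has $+1$ in $p_d$ boxes and $-1$ in $q_d$ boxes of the first column of the rectangular block of size $t_d\times d$. *)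

theory Defs
  imports "HOL-Analysis.Analysis" "HOL-Library.Multiset"
begin

text \<open>
  Vectors are indexed by the disjoint sum of two finite types \<open>'p\<close> and \<open>'q\<close>, so that
  \<open>p = CARD('p)\<close> and \<open>q = CARD('q)\<close>, both positive. On the type \<open>complex ^ 'n\<close>, the constants
  \<open>subspace\<close>, \<open>span\<close> and \<open>dim\<close> refer to the underlying real vector space; their complex
  counterparts carry the prefix \<open>vec\<close>. The overloaded \<open>*\<close> and \<open>^\<close> act entrywise, so matrix
  products are written \<open>**\<close> and matrix powers need their own constant.
\<close>

definition matrix_pow :: "'a::semiring_1^'n^'n \<Rightarrow> nat \<Rightarrow> 'a^'n^'n" where
  "matrix_pow A k = (((**) A) ^^ k) (mat 1)"

definition conj_transpose :: "complex^'n^'m \<Rightarrow> complex^'m^'n" where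
  "conj_transpose A = (\<chi> i j. cnj (A $ j $ i))"

definition commutator :: "complex^'n^'n \<Rightarrow> complex^'n^'n \<Rightarrow> complex^'n^'n" where
  "commutator A B = A ** B - B ** A"

definition nilpotent_matrix :: "complex^'n^'n \<Rightarrow> bool" where
  "nilpotent_matrix A \<longleftrightarrow> (\<exists>k. matrix_pow A k = 0)"

definition Ipq :: "complex^('p::finite + 'q::finite)^('p + 'q)" where
  "Ipq = (\<chi> i j. if i = j then (case i of Inl _ \<Rightarrow> 1 | Inr _ \<Rightarrow> -1) else 0)"

definition form_pq :: "complex^('p::finite + 'q::finite) \<Rightarrow> complex^('p + 'q) \<Rightarrow> complex" where
  "form_pq x y = (\<Sum>i\<in>UNIV. cnj (x $ i) * (Ipq *v y) $ i)"

definition SU_pq :: "(complex^('p::finite + 'q::finite)^('p + 'q)) set" where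
  "SU_pq = {g. det g = 1 \<and> conj_transpose g ** Ipq ** g = Ipq}"

definition su_pq :: "(complex^('p::finite + 'q::finite)^('p + 'q)) set" where
  "su_pq = {z. trace z = 0 \<and> conj_transpose z ** Ipq + Ipq ** z = 0}"

definition Ad :: "complex^'n^'n \<Rightarrow> complex^'n^'n \<Rightarrow> complex^'n^'n" where
  "Ad g X = g ** X ** matrix_inv g"

definition Ad_real :: "(complex^'n^'n) set \<Rightarrow> complex^'n^'n \<Rightarrow> bool" where
  "Ad_real G X \<longleftrightarrow> (\<exists>g\<in>G. - X = Ad g X)"

definition strongly_Ad_real :: "(complex^'n^'n) set \<Rightarrow> complex^'n^'n \<Rightarrow> bool" where
  "strongly_Ad_real G X \<longleftrightarrow> (\<exists>\<tau>\<in>G. \<tau> ** \<tau> = mat 1 \<and> - X = Ad \<tau> X)"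

text \<open>
  For nilpotent \<open>X\<close>, a Jordan basis with block sizes \<open>ds\<close> consists of the chains
  \<open>w j, X w j, \<dots>, X\<^sup>d\<^sup>-\<^sup>1 w j\<close> with \<open>d = ds ! j\<close> and \<open>X\<^sup>d w j = 0\<close>: in this basis
  \<open>X\<close> is the direct sum of the Jordan blocks of sizes \<open>ds ! j\<close> with eigenvalue 0.
\<close>

definition jordan_chain_basis ::
    "complex^'n^'n \<Rightarrow> nat list \<Rightarrow> (nat \<Rightarrow> complex^'n) \<Rightarrow> bool" where
  "jordan_chain_basis X ds w \<longleftrightarrow>
     (let J = {(j, i). j < length ds \<and> i < ds ! j};
          u = (\<lambda>(j, i). matrix_pow X i *v w j)
      in (\<forall>d\<in>set ds. d > 0)
       \<and> (\<forall>j<length ds. matrix_pow X (ds ! j) *v w j = 0)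
       \<and> inj_on u J \<and> vec.independent (u ` J) \<and> vec.span (u ` J) = UNIV)"

text \<open>
  The partition of a nilpotent matrix is the multiset of its Jordan block sizes;
  \<open>count (jordan_partition X) d\<close> is \<open>t\<^sub>d\<close>, and the parts are its elements.
\<close>

definition jordan_partition :: "complex^'n^'n \<Rightarrow> nat multiset" where
  "jordan_partition X = (THE D. \<exists>ds w. jordan_chain_basis X ds w \<and> D = mset ds)"

definition su_sl2_triple ::
    "complex^('p::finite + 'q::finite)^('p + 'q) \<Rightarrow> complex^('p + 'q)^('p + 'q)
      \<Rightarrow> complex^('p + 'q)^('p + 'q) \<Rightarrow> bool" where
  "su_sl2_triple X H Y \<longleftrightarrow>
     X \<in> su_pq \<and> H \<in> su_pq \<and> Y \<in> su_pq \<and>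
     commutator H X = 2 *\<^sub>R X \<and> commutator H Y = - (2 *\<^sub>R Y) \<and> commutator X Y = H"

definition real_submodule :: "(complex^'n^'n) set \<Rightarrow> (complex^'n) set \<Rightarrow> bool" where
  "real_submodule S W \<longleftrightarrow> subspace W \<and> (\<forall>Z\<in>span S. \<forall>w\<in>W. Z *v w \<in> W)"

definition irreducible_submodule :: "(complex^'n^'n) set \<Rightarrow> (complex^'n) set \<Rightarrow> bool" where
  "irreducible_submodule S W \<longleftrightarrow>
     real_submodule S W \<and> W \<noteq> {0} \<and>
     (\<forall>U. real_submodule S U \<and> U \<subseteq> W \<longrightarrow> U = {0} \<or> U = W)"

text \<open>
  The spaces \<open>M(k)\<close> and \<open>L(k)\<close>: submodules are real subspaces of \<open>V\<close>, of real dimension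
  \<open>k + 1\<close>, and their sum is the real span of their union.
\<close>

definition M_space ::
    "complex^'n^'n \<Rightarrow> complex^'n^'n \<Rightarrow> complex^'n^'n \<Rightarrow> nat \<Rightarrow> (complex^'n) set" where
  "M_space X H Y k = span (\<Union>{W. irreducible_submodule {X, H, Y} W \<and> dim W = k + 1})"

definition L_space ::
    "complex^'n^'n \<Rightarrow> complex^'n^'n \<Rightarrow> complex^'n^'n \<Rightarrow> nat \<Rightarrow> (complex^'n) set" where
  "L_space X H Y k = {v. Y *v v = 0} \<inter> M_space X H Y k"

definition adapted_basis ::
    "complex^('p::finite + 'q::finite)^('p + 'q) \<Rightarrow> complex^('p + 'q)^('p + 'q)
      \<Rightarrow> complex^('p + 'q)^('p + 'q) \<Rightarrow> nat \<Rightarrow> (nat \<Rightarrow> complex^('p + 'q)) \<Rightarrow> bool" where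
  "adapted_basis X H Y d v \<longleftrightarrow>
     (let t = count (jordan_partition X) d in
        inj_on v {1..t} \<and> vec.independent (v ` {1..t})
      \<and> vec.span (v ` {1..t}) = L_space X H Y (d - 1)
      \<and> (\<forall>j\<in>{1..t}. \<forall>k\<in>{1..t}. j \<noteq> k \<longrightarrow>
            form_pq (v j) (matrix_pow X (d - 1) *v v k) = 0)
      \<and> (\<forall>j\<in>{1..t}. form_pq (v j) (matrix_pow X (d - 1) *v v j)
            \<in> (if odd d then {1, - 1} else {\<i>, - \<i>})))"

definition plus_count ::
    "complex^('p::finite + 'q::finite)^('p + 'q) \<Rightarrow> nat \<Rightarrow> (nat \<Rightarrow> complex^('p + 'q)) \<Rightarrow> nat" where
  "plus_count X d v =
     (let t = count (jordan_partition X) d in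
      if odd d then card {j\<in>{1..t}. form_pq (v j) (matrix_pow X (d - 1) *v v j) = 1}
      else card {j\<in>{1..t}. \<i> * form_pq (v j) (matrix_pow X (d - 1) *v v j) = 1})"

text \<open>
  \<open>p\<^sub>d\<close> and \<open>q\<^sub>d\<close>, the numbers of \<open>+1\<close> and \<open>-1\<close> in the first column of the
  \<open>t\<^sub>d \<times> d\<close> block of the signed Young diagram. The count does not depend on the choice of
  the triple and of the basis, which is what the definite description expresses.
\<close>

definition p_mult :: "complex^('p::finite + 'q::finite)^('p + 'q) \<Rightarrow> nat \<Rightarrow> nat" where
  "p_mult X d =
     (THE a. \<exists>H Y v. su_sl2_triple X H Y \<and> adapted_basis X H Y d v \<and> a = plus_count X d v)"

definition q_mult :: "complex^('p::finite + 'q::finite)^('p + 'q) \<Rightarrow> nat \<Rightarrow> nat" where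
  "q_mult X d = count (jordan_partition X) d - p_mult X d"

definition even_parts :: "complex^'n^'n \<Rightarrow> nat set" where
  "even_parts X = {d \<in> set_mset (jordan_partition X). even d}"

end

theory Submission
  imports Defs
begin

text \<open>
  The space \<open>V\<close> splits orthogonally into Jordan chains \<open>w, X w, \<dots>, X\<^sup>d\<^sup>-\<^sup>1 w\<close> on each of which the
  only nonzero products pair \<open>X\<^sup>i w\<close> with \<open>X\<^sup>d\<^sup>-\<^sup>1\<^sup>-\<^sup>i w\<close>. Such chains yield an explicit
  \<open>sl\<^sub>2\<close>-triple in \<open>su(p,q)\<close> whose space \<open>L(d - 1)\<close> is spanned by the generators \<open>w\<close> of the
  chains of length \<open>d\<close>, so \<open>p\<^sub>d\<close> can be read off from them.

  For any triple, \<open>L(d - 1) \<subseteq> ker X\<^sup>d\<close>. Modulo its radical the form \<open>\<langle>x, X\<^sup>d\<^sup>-\<^sup>1 y\<rangle>\<close> on \<open>ker X\<^sup>d\<close>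
  has rank \<open>t\<^sub>d\<close>. Hence \<open>p\<^sub>d\<close> does not depend on the choices. An element \<open>g\<close> with
  \<open>g X g\<^sup>-\<^sup>1 = - X\<close> multiplies this form by \<open>(-1)\<^sup>d\<^sup>-\<^sup>1\<close>, which forces \<open>p\<^sub>d = q\<^sub>d\<close> for even \<open>d\<close>.
  Conversely, if \<open>p\<^sub>d = q\<^sub>d\<close> for even \<open>d\<close>, pair the positive with the negative chains of length \<open>d\<close>
  and let \<open>\<tau>\<close> swap the members of each pair and act by alternating signs along every chain.
\<close>

section \<open>Matrices and the Hermitian form\<close>

text \<open>The definite description of p_d ranges over all triples and adapted bases. For the
  explicit triple L(d - 1) is computed exactly; for an arbitrary one only the inclusion in ker X^d
  is established. Independence therefore comes from an inequality: vectors of ker X^d with positive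
  values from one basis and with negative values from another number at most t_d together, and
  exchanging the bases gives equality. The same bound, with the second family the image of the first
  under g, gives p_d = q_d.

  The remaining obstacle is det tau = 1. Alternating signs have product (-1)^(d div 2) along a chain
  of length d. On a chain of odd length an overall sign repairs this without affecting the form,
  tau^2 = 1 or tau X = - X tau. On a chain of even length such a sign leaves the determinant
  unchanged; there the factors cancel because the two chains of a swapped pair have equal lengths,
  and the permutation of the basis is even because swapping them takes d transpositions.\<close>

lemma matrix_pow_0 [simp]: "matrix_pow A 0 = mat 1"
  by (simp add: matrix_pow_def)

lemma matrix_pow_Suc: "matrix_pow A (Suc k) = A ** matrix_pow A k"
  by (simp add: matrix_pow_def)

lemma matrix_pow_add: "matrix_pow A (a + b) = matrix_pow A a ** matrix_pow A b"
  by (induction a) (simp_all add: matrix_pow_Suc matrix_mul_assoc)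

lemma matrix_pow_add_vec:
  fixes A :: "complex^'n^'n"
  shows "matrix_pow A (a + b) *v x = matrix_pow A a *v (matrix_pow A b *v x)"
  by (simp add: matrix_pow_add matrix_vector_mul_assoc)

lemma matrix_pow_Suc_vec:
  fixes A :: "complex^'n^'n"
  shows "matrix_pow A (Suc k) *v x = A *v (matrix_pow A k *v x)"
  by (simp add: matrix_pow_Suc matrix_vector_mul_assoc)

lemma matrix_pow_Suc_vec':
  fixes A :: "complex^'n^'n"
  shows "matrix_pow A (Suc k) *v x = matrix_pow A k *v (A *v x)"
  using matrix_pow_add_vec[of A k 1 x] by (simp add: matrix_pow_Suc)

lemma matrix_pow_eq_0_mono:
  fixes A :: "complex^'n^'n"
  assumes "matrix_pow A k *v x = 0" "k \<le> l"
  shows "matrix_pow A l *v x = 0"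
proof -
  have "matrix_pow A l *v x = matrix_pow A (l - k) *v (matrix_pow A k *v x)"
    using assms(2) by (simp flip: matrix_pow_add_vec)
  then show ?thesis using assms(1) by simp
qed

lemma scaleR_eq_scalar_mult: "r *\<^sub>R x = of_real r *s (x :: complex^'n)"
  by (simp only: vec_eq_iff vector_scaleR_component vector_smult_component
      scaleR_conv_of_real[where 'a = complex] simp_thms)

lemma scaleR_matrix_vector_mult: "(r *\<^sub>R A) *v x = r *\<^sub>R (A *v (x :: complex^'n))"
  for A :: "complex^'n^'m"
  by (simp add: vec_eq_iff matrix_vector_mult_def scaleR_right.sum)

lemma minus_matrix_vector_mult: "(- A) *v x = - (A *v (x :: complex^'n))"
  for A :: "complex^'n^'m"
  by (simp add: vec_eq_iff matrix_vector_mult_def sum_negf)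

lemma vec_subspace_imp_subspace: "vec.subspace S \<Longrightarrow> subspace (S :: (complex^'n) set)"
  by (auto simp: vec.subspace_def subspace_def scaleR_eq_scalar_mult)

lemma matrix_vector_eq_on_span:
  fixes A B :: "complex^'n^'m"
  assumes "x \<in> vec.span S" "\<And>x. x \<in> S \<Longrightarrow> A *v x = B *v x"
  shows "A *v x = B *v x"
  using assms(1)
  by (induction rule: vec.span_induct_alt)
    (auto simp: assms(2) matrix_vector_right_distrib vec.scale)

lemma matrix_eq_on_spanning:
  fixes A B :: "complex^'n^'m"
  assumes "vec.span S = UNIV" "\<And>x. x \<in> S \<Longrightarrow> A *v x = B *v x"
  shows "A = B"
  using matrix_vector_eq_on_span[of _ S A B] assms by (simp add: matrix_eq)

lemma obtain_matrix_on_basis: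
  fixes u :: "'k \<Rightarrow> complex^'n" and f :: "'k \<Rightarrow> complex^'m"
  assumes "inj_on u K" "vec.independent (u ` K)"
  obtains T :: "complex^'n^'m" where "\<And>k. k \<in> K \<Longrightarrow> T *v u k = f k"
proof -
  obtain g where g: "Vector_Spaces.linear (*s) (*s) g" "\<forall>x\<in>u ` K. g x = f (the_inv_into K u x)"
    using vec.linear_independent_extend[OF assms(2), where f = "f \<circ> the_inv_into K u"] by auto
  show thesis
    by (rule that[of "matrix g"]) (use g assms(1) in \<open>simp add: matrix_works the_inv_into_f_f\<close>)
qed

lemma independent_familyI:
  fixes f :: "'k \<Rightarrow> complex^'n"
  assumes "finite K" and "\<And>c. (\<Sum>k\<in>K. c k *s f k) = 0 \<Longrightarrow> \<forall>k\<in>K. c k = 0"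
  shows "inj_on f K" "vec.independent (f ` K)"
proof -
  show inj: "inj_on f K"
  proof (rule inj_onI, rule ccontr)
    fix a b assume ab: "a \<in> K" "b \<in> K" "f a = f b" "a \<noteq> b"
    define c :: "'k \<Rightarrow> complex" where "c = (\<lambda>k. if k = a then 1 else if k = b then -1 else 0)"
    have "(\<Sum>k\<in>K. c k *s f k) = (\<Sum>k\<in>{a,b}. c k *s f k)"
      by (rule sum.mono_neutral_right) (use assms(1) ab in \<open>auto simp: c_def\<close>)
    also have "\<dots> = 0" using ab by (simp add: c_def)
    finally have "c a = 0" using assms(2) ab by blast
    then show False by (simp add: c_def)
  qed
  show "vec.independent (f ` K)"
  proof (rule vec.independent_if_scalars_zero)
    show "finite (f ` K)" using assms(1) by simp
    fix g x assume "(\<Sum>x\<in>f ` K. g x *s x) = 0" "x \<in> f ` K"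
    then show "g x = 0"
      using assms(2)[of "g \<circ> f"] by (auto simp: sum.reindex[OF inj])
  qed
qed

section \<open>Sesquilinearity, nondegeneracy and adjoints for the form\<close>

lemma form_pq_add_left: "form_pq (x + y) z = form_pq x z + form_pq y z"
  by (simp add: form_pq_def algebra_simps sum.distrib)

lemma form_pq_add_right: "form_pq x (y + z) = form_pq x y + form_pq x z"
  by (simp add: form_pq_def algebra_simps sum.distrib matrix_vector_right_distrib)

lemma form_pq_scale_left: "form_pq (c *s x) y = cnj c * form_pq x y"
  by (simp add: form_pq_def sum_distrib_left mult.assoc)

lemma form_pq_scale_right: "form_pq x (c *s y) = c * form_pq x y"
  by (simp add: form_pq_def sum_distrib_left vec.scale mult_ac)

lemma form_pq_scaleR_left: "form_pq (r *\<^sub>R x) y = r * form_pq x y"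
  by (simp add: scaleR_eq_scalar_mult form_pq_scale_left)

lemma form_pq_scaleR_right: "form_pq x (r *\<^sub>R y) = r * form_pq x y"
  by (simp add: scaleR_eq_scalar_mult form_pq_scale_right)

lemma form_pq_0_left [simp]: "form_pq 0 x = 0"
  by (simp add: form_pq_def)

lemma form_pq_0_right [simp]: "form_pq x 0 = 0"
  by (simp add: form_pq_def)

lemma form_pq_minus_left: "form_pq (- x) y = - form_pq x y"
  using form_pq_scale_left[of "-1"] by simp

lemma form_pq_minus_right: "form_pq x (- y) = - form_pq x y"
  using form_pq_scale_right[of x "-1"] by simp

lemma form_pq_diff_left: "form_pq (x - y) z = form_pq x z - form_pq y z"
  using form_pq_add_left[of x "- y"] by (simp add: form_pq_minus_left)

lemma form_pq_diff_right: "form_pq x (y - z) = form_pq x y - form_pq x z"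
  using form_pq_add_right[of x y "- z"] by (simp add: form_pq_minus_right)

lemma form_pq_sum_left: "form_pq (sum f A) y = (\<Sum>a\<in>A. form_pq (f a) y)"
  by (induction A rule: infinite_finite_induct) (simp_all add: form_pq_add_left)

lemma form_pq_sum_right: "form_pq x (sum f A) = (\<Sum>a\<in>A. form_pq x (f a))"
  by (induction A rule: infinite_finite_induct) (simp_all add: form_pq_add_right)

definition sign_pq :: "'p + 'q \<Rightarrow> complex" where
  "sign_pq i = (case i of Inl _ \<Rightarrow> 1 | Inr _ \<Rightarrow> -1)"

lemma Ipq_mult_vec: "(Ipq *v y) $ i = sign_pq i * y $ i"
  by (simp add: Ipq_def matrix_vector_mult_def sign_pq_def if_distrib[of "\<lambda>a. a * _"]
      sum.delta cong: if_cong)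

lemma form_pq_expand: "form_pq x y = (\<Sum>i\<in>UNIV. sign_pq i * (cnj (x $ i) * y $ i))"
  by (simp add: form_pq_def Ipq_mult_vec mult_ac)

lemma form_pq_cnj: "form_pq y x = cnj (form_pq x y)"
  by (auto simp: form_pq_expand sign_pq_def intro!: sum.cong split: sum.splits)

lemma form_pq_axis_left: "form_pq (axis i 1) y = sign_pq i * y $ i"
proof -
  have "form_pq (axis i 1) y = (\<Sum>k\<in>UNIV. if k = i then sign_pq i * y $ i else 0)"
    unfolding form_pq_expand by (rule sum.cong) (auto simp: axis_def)
  then show ?thesis by simp
qed

lemma form_pq_nondegenerate:
  assumes "\<And>x. form_pq x y = 0"
  shows "y = 0"
proof -
  have "y $ i = 0" for i
    using assms[of "axis i 1"] by (simp add: form_pq_axis_left sign_pq_def split: sum.splits)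
  then show ?thesis by (simp add: vec_eq_iff)
qed

lemma Ipq_squared: "Ipq ** Ipq = (mat 1 :: complex^('p::finite + 'q::finite)^('p + 'q))"
  by (simp add: matrix_eq vec_eq_iff Ipq_mult_vec sign_pq_def split: sum.splits flip: matrix_vector_mul_assoc)

lemma conj_transpose_form:
  "(\<Sum>i\<in>UNIV. cnj ((A *v x) $ i) * y $ i) = (\<Sum>i\<in>UNIV. cnj (x $ i) * (conj_transpose A *v y) $ i)"
  by (simp add: matrix_vector_mult_def conj_transpose_def sum_distrib_left sum_distrib_right)
    (subst sum.swap, simp add: mult_ac)

text \<open>Since \<open>Ipq\<close> is its own inverse,
  \<open>Ipq ** conj_transpose A ** Ipq\<close> is the adjoint of \<open>A\<close> for the form. The
  membership conditions of \<open>su_pq\<close> and \<open>SU_pq\<close> become statements about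
  this adjoint.\<close>

lemma form_pq_mult_left: "form_pq (A *v x) y = form_pq x ((Ipq ** conj_transpose A ** Ipq) *v y)"
proof -
  have "Ipq *v ((Ipq ** conj_transpose A ** Ipq) *v y) = conj_transpose A *v (Ipq *v y)"
    by (simp add: matrix_vector_mul_assoc matrix_mul_assoc Ipq_squared)
  then show ?thesis by (simp add: form_pq_def conj_transpose_form)
qed

lemma matrix_eq_if_form_pq_eq:
  assumes "\<And>x y. form_pq x (A *v y) = form_pq x (B *v y)"
  shows "A = B"
proof -
  have "A *v y - B *v y = 0" for y
    by (rule form_pq_nondegenerate) (simp add: form_pq_diff_right assms)
  then show ?thesis by (simp add: matrix_eq)
qed

lemma su_pq_iff:
  "z \<in> su_pq \<longleftrightarrow> trace z = 0 \<and> (\<forall>x y. form_pq (z *v x) y = - form_pq x (z *v y))"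
proof -
  let ?M = "Ipq ** conj_transpose z ** Ipq"
  have "conj_transpose z ** Ipq + Ipq ** z = 0 \<longleftrightarrow> Ipq ** (conj_transpose z ** Ipq + Ipq ** z) = 0"
  proof
    assume "Ipq ** (conj_transpose z ** Ipq + Ipq ** z) = 0"
    then have "Ipq ** (Ipq ** (conj_transpose z ** Ipq + Ipq ** z)) = 0" by simp
    then show "conj_transpose z ** Ipq + Ipq ** z = 0"
      by (simp add: matrix_mul_assoc Ipq_squared)
  qed simp
  also have "Ipq ** (conj_transpose z ** Ipq + Ipq ** z) = ?M + z"
    by (simp add: matrix_add_ldistrib matrix_mul_assoc Ipq_squared)
  also have "?M + z = 0 \<longleftrightarrow> ?M = - z"
    by (rule eq_neg_iff_add_eq_0[symmetric])
  also have "\<dots> \<longleftrightarrow> (\<forall>x y. form_pq x (?M *v y) = form_pq x (- z *v y))"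
    using matrix_eq_if_form_pq_eq by metis
  also have "\<dots> \<longleftrightarrow> (\<forall>x y. form_pq (z *v x) y = - form_pq x (z *v y))"
    by (simp add: form_pq_mult_left minus_matrix_vector_mult form_pq_minus_right)
  finally show ?thesis by (simp add: su_pq_def)
qed

lemma SU_pq_iff:
  "g \<in> SU_pq \<longleftrightarrow> det g = 1 \<and> (\<forall>x y. form_pq (g *v x) (g *v y) = form_pq x y)"
proof -
  let ?M = "Ipq ** conj_transpose g ** Ipq ** g"
  have "conj_transpose g ** Ipq ** g = Ipq \<longleftrightarrow> ?M = mat 1"
  proof
    assume "conj_transpose g ** Ipq ** g = Ipq"
    then have "Ipq ** (conj_transpose g ** Ipq ** g) = Ipq ** Ipq" by simp
    then show "?M = mat 1" by (simp add: matrix_mul_assoc Ipq_squared)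
  next
    assume "?M = mat 1"
    then have "Ipq ** ?M = Ipq ** mat 1" by simp
    then show "conj_transpose g ** Ipq ** g = Ipq" by (simp add: matrix_mul_assoc Ipq_squared)
  qed
  also have "\<dots> \<longleftrightarrow> (\<forall>x y. form_pq x (?M *v y) = form_pq x (mat 1 *v y))"
    using matrix_eq_if_form_pq_eq by metis
  also have "\<dots> \<longleftrightarrow> (\<forall>x y. form_pq (g *v x) (g *v y) = form_pq x y)"
    by (simp add: form_pq_mult_left matrix_vector_mul_assoc)
  finally show ?thesis by (simp add: SU_pq_def)
qed

text \<open>Sesquilinearity reduces the identity to a spanning set. The four matrices and the factor
  \<open>c\<close> cover both applications: skewness of a map (\<open>c = -1\<close>, the identity
  in two places) and invariance of the form (\<open>c = 1\<close>).\<close>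

lemma form_pq_eq_on_spanning:
  assumes "vec.span S = UNIV"
    and "\<And>x y. x \<in> S \<Longrightarrow> y \<in> S \<Longrightarrow> form_pq (A *v x) (B *v y) = c * form_pq (C *v x) (D *v y)"
  shows "form_pq (A *v x) (B *v y) = c * form_pq (C *v x) (D *v y)"
proof -
  have *: "form_pq (A *v x) (B *v y) = c * form_pq (C *v x) (D *v y)" if "x \<in> S" for x y
  proof -
    have "y \<in> vec.span S" using assms(1) by simp
    then show ?thesis
      by (induction rule: vec.span_induct_alt)
        (use that assms(2) in \<open>auto simp: matrix_vector_right_distrib vec.scale form_pq_add_right
           form_pq_scale_right algebra_simps\<close>)
  qed
  have "x \<in> vec.span S" using assms(1) by simp
  then show ?thesis
    by (induction rule: vec.span_induct_alt)
      (auto simp: * matrix_vector_right_distrib vec.scale form_pq_add_left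
         form_pq_scale_left algebra_simps)
qed

text \<open>Membership in the Lie algebra u(p,q). The trace condition of \<open>su_pq\<close> is
  kept apart; it enters with the triple.\<close>

definition skew_pq :: "complex^('p::finite + 'q::finite)^('p + 'q) \<Rightarrow> bool" where
  "skew_pq X \<longleftrightarrow> (\<forall>x y. form_pq (X *v x) y = - form_pq x (X *v y))"

lemma skew_pq_pow_left:
  assumes "skew_pq X"
  shows "form_pq (matrix_pow X k *v x) y = (-1) ^ k * form_pq x (matrix_pow X k *v y)"
proof (induction k arbitrary: y)
  case (Suc k)
  then show ?case using assms
    by (simp add: matrix_pow_Suc_vec[of _ _ x] matrix_pow_Suc_vec'[of _ _ y] skew_pq_def)
qed simp

lemma skew_pq_pow_both:
  assumes "skew_pq X"
  shows "form_pq (matrix_pow X k *v x) (matrix_pow X l *v y)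
         = (-1) ^ k * form_pq x (matrix_pow X (k + l) *v y)"
  by (simp add: skew_pq_pow_left[OF assms] matrix_pow_add_vec)

lemma skew_pq_pow_cnj:
  assumes "skew_pq X"
  shows "cnj (form_pq x (matrix_pow X k *v y)) = (-1) ^ k * form_pq y (matrix_pow X k *v x)"
  using skew_pq_pow_left[OF assms, of k y x] by (simp add: form_pq_cnj[of "matrix_pow X k *v y" x])

section \<open>Orthogonal Jordan chains\<close>

text \<open>The values c = 1 and c = i give the sum and the difference of the two cross terms, so
  both vanish. It is used in contrapositive form: a nonzero product yields a vector whose product
  with itself is nonzero.\<close>

lemma skew_pq_polarization:
  assumes "vec.subspace W" "skew_pq X" "\<And>v. v \<in> W \<Longrightarrow> form_pq v (matrix_pow X k *v v) = 0"
    and "x \<in> W" "y \<in> W"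
  shows "form_pq y (matrix_pow X k *v x) = 0"
proof -
  let ?B = "\<lambda>x y. form_pq x (matrix_pow X k *v y)"
  have expand: "?B (y + c *s x) (y + c *s x) = ?B y y + c * ?B y x + cnj c * ?B x y + c * cnj c * ?B x x" for c
    by (simp add: matrix_vector_right_distrib vec.scale form_pq_add_left form_pq_add_right
        form_pq_scale_left form_pq_scale_right algebra_simps)
  have "c * ?B y x + cnj c * ?B x y = 0" for c
  proof -
    have "y + c *s x \<in> W" using assms by (simp add: vec.subspace_add vec.subspace_scale)
    then show ?thesis using expand[of c] assms by simp
  qed
  from this[of 1] this[of \<i>] show ?thesis
    by (simp flip: right_diff_distrib)
qed

text \<open>Triangular elimination, from the power n - 1 downwards. Adding
  \<open>c *s (matrix_pow X (Suc m) *v v')\<close> changes the product at the power a only by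
  products at a + m + 1 and a + 2m + 2. These vanish for a > n - m - 1, so earlier gains persist; at
  a = n - m - 1 the first of them is the nonzero \<open>b\<close>, so \<open>c\<close> can be solved
  for.\<close>

lemma skew_pq_isotropic_lower_powers:
  assumes "vec.subspace W" "skew_pq X" and inv: "\<And>x. x \<in> W \<Longrightarrow> X *v x \<in> W"
    and nil: "\<And>x. x \<in> W \<Longrightarrow> matrix_pow X (Suc n) *v x = 0"
    and v: "v \<in> W" "form_pq v (matrix_pow X n *v v) \<noteq> 0"
  shows "\<exists>v'\<in>W. form_pq v' (matrix_pow X n *v v') = form_pq v (matrix_pow X n *v v) \<and>
           (\<forall>a<n. form_pq v' (matrix_pow X a *v v') = 0)"
proof -
  define b where "b = form_pq v (matrix_pow X n *v v)"
  have invp: "matrix_pow X a *v x \<in> W" if "x \<in> W" for a x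
    using that by (induction a) (auto simp: matrix_pow_Suc_vec inv)
  have "\<exists>v'\<in>W. form_pq v' (matrix_pow X n *v v') = b \<and>
           (\<forall>a. n - m \<le> a \<and> a < n \<longrightarrow> form_pq v' (matrix_pow X a *v v') = 0)" if "m \<le> n" for m
    using that
  proof (induction m)
    case 0
    then show ?case using v b_def by auto
  next
    case (Suc m)
    then obtain v' where v': "v' \<in> W" "form_pq v' (matrix_pow X n *v v') = b"
      "\<And>a. n - m \<le> a \<Longrightarrow> a < n \<Longrightarrow> form_pq v' (matrix_pow X a *v v') = 0" by auto
    define F where "F = (\<lambda>a. form_pq v' (matrix_pow X a *v v'))"
    define k where "k = n - Suc m"
    have n: "n = Suc m + k" using Suc by (simp add: k_def)
    have F0: "F a = 0" if "n < a" for a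
      unfolding F_def using matrix_pow_eq_0_mono[OF nil[OF v'(1)], of a] that by simp
    have Fcnj: "cnj (F a) = (-1) ^ a * F a" for a
      unfolding F_def using skew_pq_pow_cnj[OF assms(2)] by simp
    have Fn: "F n = b" using v' by (simp add: F_def)
    have b0: "b \<noteq> 0" using v by (simp add: b_def)
    text \<open>Since \<open>cnj (F a) = (-1)^a * F a\<close>, the two cross terms in the expansion below
      are equal at \<open>a = k\<close>, whence the factor 2.\<close>
    define c where "c = - F k / (2 * b)"
    have cc: "(-1) ^ Suc m * cnj c = c"
    proof -
      have "cnj b = (-1) ^ n * b" using Fcnj[of n] Fn by simp
      then show ?thesis using b0
        by (cases "even m"; cases "even k") (auto simp: c_def Fcnj n power_add)
    qed
    define z where "z = v' + c *s (matrix_pow X (Suc m) *v v')"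
    have expand: "form_pq z (matrix_pow X a *v z) =
       F a + (c + (-1) ^ Suc m * cnj c) * F (a + Suc m) + c * cnj c * (-1) ^ Suc m * F (a + Suc m + Suc m)" for a
    proof -
      have 1: "matrix_pow X a *v (matrix_pow X (Suc m) *v v') = matrix_pow X (a + Suc m) *v v'"
        by (simp only: matrix_pow_add_vec)
      have 2: "form_pq (matrix_pow X (Suc m) *v v') (matrix_pow X b *v v') = (-1) ^ Suc m * F (b + Suc m)" for b
        using skew_pq_pow_both[OF assms(2), of "Suc m" v' b v'] by (simp add: F_def add_ac)
      show ?thesis
        unfolding z_def matrix_vector_right_distrib vec.scale form_pq_add_left form_pq_add_right
          form_pq_scale_left form_pq_scale_right 1 2
        unfolding F_def[symmetric] by (simp add: algebra_simps F_def)
    qed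
    have "z \<in> W" unfolding z_def using v' invp assms(1) by (simp add: vec.subspace_add vec.subspace_scale)
    moreover have "form_pq z (matrix_pow X n *v z) = b"
      unfolding expand by (simp add: F0 Fn)
    moreover have "form_pq z (matrix_pow X a *v z) = 0" if "n - Suc m \<le> a" "a < n" for a
    proof (cases "a = k")
      case True
      have "F (a + Suc m) = b" using True n Fn by (simp add: add_ac)
      moreover have "F (a + Suc m + Suc m) = 0" using True n by (intro F0) simp
      ultimately show ?thesis unfolding expand cc using True b0 by (simp add: c_def)
    next
      case False
      then have "F a = 0" using v'(3)[of a] that k_def by (simp add: F_def)
      moreover have "F (a + Suc m) = 0" "F (a + Suc m + Suc m) = 0"
        using False that n by (intro F0, simp)+
      ultimately show ?thesis unfolding expand by simp
    qed
    ultimately show ?case by blast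
  qed
  from this[of n] show ?thesis by (auto simp: b_def)
qed

text \<open>The values of modulus 1 that b = <v, X^(d-1) v> can take: skewness gives cnj b = (-1)^(d
  - 1) b, so b is real for odd d and imaginary for even d.\<close>

definition unit_signs :: "nat \<Rightarrow> complex set" where
  "unit_signs d = (if odd d then {1, -1} else {\<i>, -\<i>})"

lemma skew_pq_normalized_chain:
  assumes "vec.subspace W" "skew_pq X" and inv: "\<And>x. x \<in> W \<Longrightarrow> X *v x \<in> W"
    and "W \<noteq> {0}" and nil: "\<And>x. matrix_pow X N *v x = 0"
    and nondeg: "\<And>x. x \<in> W \<Longrightarrow> (\<And>y. y \<in> W \<Longrightarrow> form_pq y x = 0) \<Longrightarrow> x = 0"
  shows "\<exists>d v. d > 0 \<and> v \<in> W \<and> matrix_pow X d *v v = 0 \<and>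
     (\<forall>a. Suc a \<noteq> d \<longrightarrow> form_pq v (matrix_pow X a *v v) = 0) \<and>
     form_pq v (matrix_pow X (d - 1) *v v) \<in> unit_signs d"
proof -
  \<comment> \<open>The nilpotency index of X on \<open>W\<close>. By nondegeneracy the form built
    from X^(d-1) is then not identically zero on \<open>W\<close>, and polarization finds a vector
    on which it does not vanish.\<close>
  define d where "d = (LEAST k. \<forall>x\<in>W. matrix_pow X k *v x = 0)"
  have d: "matrix_pow X d *v x = 0" if "x \<in> W" for x
    unfolding d_def by (rule LeastI2[where a = N]) (use nil that in auto)
  obtain x0 where x0: "x0 \<in> W" "x0 \<noteq> 0"
    using \<open>W \<noteq> {0}\<close> vec.subspace_0[OF assms(1)] by blast
  then have "d \<noteq> 0" using d[OF x0(1)] by (intro notI) simp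
  then obtain n where n: "d = Suc n" by (cases d) auto
  have invp: "matrix_pow X a *v x \<in> W" if "x \<in> W" for a x
    using that by (induction a) (auto simp: matrix_pow_Suc_vec inv)
  have "\<not> (\<forall>x\<in>W. matrix_pow X n *v x = 0)"
    using not_less_Least[of n "\<lambda>k. \<forall>x\<in>W. matrix_pow X k *v x = 0"] n d_def by auto
  then obtain x where x: "x \<in> W" "matrix_pow X n *v x \<noteq> 0" by blast
  then obtain y where y: "y \<in> W" "form_pq y (matrix_pow X n *v x) \<noteq> 0"
    using nondeg[OF invp[OF x(1)]] by blast
  obtain v0 where v0: "v0 \<in> W" "form_pq v0 (matrix_pow X n *v v0) \<noteq> 0"
    using skew_pq_polarization[OF assms(1,2) _ x(1) y(1), of n] y(2) by blast
  obtain v1 where v1: "v1 \<in> W" "form_pq v1 (matrix_pow X n *v v1) \<noteq> 0"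
    "\<forall>a<n. form_pq v1 (matrix_pow X a *v v1) = 0"
    using skew_pq_isotropic_lower_powers[OF assms(1,2) inv _ v0] d n v0(2) by metis
  define b where "b = form_pq v1 (matrix_pow X n *v v1)"
  define r where "r = complex_of_real (1 / sqrt (cmod b))"
  define v where "v = r *s v1"
  have fv: "form_pq v (matrix_pow X a *v v) = form_pq v1 (matrix_pow X a *v v1) / cmod b" for a
  proof -
    have "cnj r * r = complex_of_real (1 / sqrt (cmod b) * (1 / sqrt (cmod b)))"
      by (simp only: r_def complex_cnj_complex_of_real of_real_mult)
    also have "\<dots> = 1 / cmod b" by simp
    finally show ?thesis
      by (simp add: v_def vec.scale form_pq_scale_left form_pq_scale_right mult.assoc[symmetric] mult.commute[of r])
  qed
  have "v \<in> W" unfolding v_def using v1 assms(1) by (simp add: vec.subspace_scale)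
  moreover have "form_pq v (matrix_pow X a *v v) = 0" if "Suc a \<noteq> d" for a
  proof (cases "a < n")
    case True then show ?thesis using v1 fv by simp
  next
    case False
    then have "matrix_pow X a *v v = 0"
      using matrix_pow_eq_0_mono[OF d[OF \<open>v \<in> W\<close>]] that n by simp
    then show ?thesis by simp
  qed
  moreover have "form_pq v (matrix_pow X (d - 1) *v v) \<in> unit_signs d"
  proof -
    have b0: "b \<noteq> 0" using v1 by (simp add: b_def)
    have cb: "cnj b = (-1) ^ n * b" unfolding b_def using skew_pq_pow_cnj[OF assms(2)] .
    have "b / cmod b \<in> unit_signs d"
    proof (cases "even n")
      case True
      then have "Im b = 0" using cb by (simp add: complex_eq_iff)
      then have "b = of_real (Re b)" by (simp add: complex_eq_iff)
      then obtain s where s: "b = of_real s" by blast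
      then show ?thesis using True n b0 by (cases "s > 0") (auto simp: unit_signs_def)
    next
      case False
      then have "Re b = 0" using cb by (simp add: complex_eq_iff)
      then have "b = \<i> * of_real (Im b)" by (simp add: complex_eq_iff)
      then obtain s where s: "b = \<i> * of_real s" by blast
      then show ?thesis using False n b0 by (cases "s > 0") (auto simp: unit_signs_def norm_mult)
    qed
    then show ?thesis using n fv by (simp add: b_def)
  qed
  ultimately show ?thesis using d \<open>d \<noteq> 0\<close> by blast
qed

definition chain_vectors :: "complex^'n^'n \<Rightarrow> nat list \<Rightarrow> (nat \<Rightarrow> complex^'n) \<Rightarrow> (complex^'n) set" where
  "chain_vectors X ds w = (\<lambda>(j, i). matrix_pow X i *v w j) ` {(j, i). j < length ds \<and> i < ds ! j}"

text \<open>Only products with a generator on the left are prescribed; skewness moves powers of X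
  across the form, so these determine the whole Gram matrix (see \<open>gram\<close>).\<close>

definition orthogonal_chains ::
    "complex^('p::finite + 'q::finite)^('p + 'q) \<Rightarrow> nat list \<Rightarrow> (nat \<Rightarrow> complex^('p + 'q)) \<Rightarrow> bool" where
  "orthogonal_chains X ds w \<longleftrightarrow>
     (\<forall>d\<in>set ds. d > 0) \<and>
     (\<forall>j<length ds. matrix_pow X (ds ! j) *v w j = 0) \<and>
     (\<forall>j<length ds. \<forall>k<length ds. \<forall>a. j \<noteq> k \<or> Suc a \<noteq> ds ! j \<longrightarrow>
        form_pq (w j) (matrix_pow X a *v w k) = 0) \<and>
     (\<forall>j<length ds. form_pq (w j) (matrix_pow X (ds ! j - 1) *v w j) \<in> unit_signs (ds ! j))"

lemma chain_vectors_snoc: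
  "chain_vectors X (ds @ [d]) (w(length ds := v)) =
     chain_vectors X ds w \<union> (\<lambda>i. matrix_pow X i *v v) ` {..<d}" (is "?L = ?R")
proof
  show "?L \<subseteq> ?R" unfolding chain_vectors_def
    by (auto simp: nth_append less_Suc_eq split: if_splits)
  show "?R \<subseteq> ?L"
  proof
    fix x assume "x \<in> ?R"
    then consider j i where "j < length ds" "i < ds ! j" "x = matrix_pow X i *v w j"
      | i where "i < d" "x = matrix_pow X i *v v"
      by (auto simp: chain_vectors_def)
    then show "x \<in> ?L"
    proof cases
      case 1
      then show ?thesis unfolding chain_vectors_def
        by (intro image_eqI[of _ _ "(j, i)"]) (auto simp: nth_append)
    next
      case 2
      then show ?thesis unfolding chain_vectors_def
        by (intro image_eqI[of _ _ "(length ds, i)"]) auto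
    qed
  qed
qed

lemma unit_signs_nonzero: "s \<in> unit_signs d \<Longrightarrow> s \<noteq> 0"
  by (auto simp: unit_signs_def split: if_splits)

text \<open>Induction on the complex dimension: the form is nondegenerate on the span of one
  normalized chain, so the orthogonal space \<open>W'\<close> in \<open>W\<close> is a complement.
  It is X-invariant by skewness and inherits nondegeneracy.\<close>

lemma orthogonal_chains_exist_on:
  assumes "skew_pq X" and nil: "\<And>x. matrix_pow X N *v x = 0"
    and "vec.subspace W" "\<And>x. x \<in> W \<Longrightarrow> X *v x \<in> W"
    and "\<And>x. x \<in> W \<Longrightarrow> (\<And>y. y \<in> W \<Longrightarrow> form_pq y x = 0) \<Longrightarrow> x = 0"
  shows "\<exists>ds w. orthogonal_chains X ds w \<and> vec.span (chain_vectors X ds w) = W"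
  using assms(3-)
proof (induction "vec.dim W" arbitrary: W rule: less_induct)
  case less
  note sub = less.prems(1) and inv = less.prems(2) and nondeg = less.prems(3)
  show ?case
  proof (cases "W = {0}")
    case True
    have "orthogonal_chains X [] (\<lambda>_. 0)" "chain_vectors X [] (\<lambda>_. 0) = {}"
      by (auto simp: orthogonal_chains_def chain_vectors_def)
    then show ?thesis using True vec.span_empty by metis
  next
    case False
    obtain d v where d: "d > 0" and v: "v \<in> W" "matrix_pow X d *v v = 0"
      and orth: "\<And>a. Suc a \<noteq> d \<Longrightarrow> form_pq v (matrix_pow X a *v v) = 0"
      and norm: "form_pq v (matrix_pow X (d - 1) *v v) \<in> unit_signs d"
      using skew_pq_normalized_chain[OF sub assms(1) inv False nil nondeg] by blast
    have invp: "matrix_pow X a *v x \<in> W" if "x \<in> W" for a x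
      using that by (induction a) (auto simp: matrix_pow_Suc_vec inv)
    define W' where "W' = {x \<in> W. \<forall>i. form_pq (matrix_pow X i *v v) x = 0}"
    have W': "vec.subspace W'" using sub
      by (auto simp: W'_def vec.subspace_def form_pq_add_right form_pq_scale_right)
    have invW': "X *v x \<in> W'" if "x \<in> W'" for x
    proof -
      have "form_pq (matrix_pow X i *v v) (X *v x) = - form_pq (matrix_pow X (Suc i) *v v) x" for i
        using assms(1) by (simp add: skew_pq_def matrix_pow_Suc_vec)
      then show ?thesis using that inv by (simp add: W'_def)
    qed
    have invpW': "matrix_pow X a *v x \<in> W'" if "x \<in> W'" for a x
      using that by (induction a) (auto simp: matrix_pow_Suc_vec invW')
    have gram: "form_pq (matrix_pow X i *v v) (matrix_pow X l *v v) \<noteq> 0 \<longleftrightarrow> Suc (i + l) = d" for i l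
      unfolding skew_pq_pow_both[OF assms(1)]
      using orth[of "i + l"] unit_signs_nonzero[OF norm] by (cases "Suc (i + l) = d") auto
    have decomp: "\<exists>c. x - (\<Sum>i<d. c i *s (matrix_pow X i *v v)) \<in> W'" if "x \<in> W" for x
    proof -
      \<comment> \<open>The Gram matrix of the chain is antidiagonal, so the coefficient at X^i v is
        read off by pairing with X^(d-1-i) v.\<close>
      define c where "c = (\<lambda>i. form_pq (matrix_pow X (d - 1 - i) *v v) x /
         form_pq (matrix_pow X (d - 1 - i) *v v) (matrix_pow X i *v v))"
      let ?y = "x - (\<Sum>i<d. c i *s (matrix_pow X i *v v))"
      have "form_pq (matrix_pow X l *v v) ?y = 0" for l
      proof (cases "l < d")
        case True
        have "(\<Sum>i<d. c i * form_pq (matrix_pow X l *v v) (matrix_pow X i *v v)) =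
              (\<Sum>i\<in>{d - 1 - l}. c i * form_pq (matrix_pow X l *v v) (matrix_pow X i *v v))"
        proof (rule sum.mono_neutral_right)
          show "\<forall>i\<in>{..<d} - {d - 1 - l}. c i * form_pq (matrix_pow X l *v v) (matrix_pow X i *v v) = 0"
            using gram[of l] True by (metis DiffE diff_Suc_1' diff_diff_left diff_add_inverse insertI1
                mult_zero_right plus_1_eq_Suc add_Suc)
        qed (use True in auto)
        also have "\<dots> = form_pq (matrix_pow X l *v v) x"
          using True gram[of l "d - 1 - l"] by (simp add: c_def)
        finally show ?thesis
          by (simp add: form_pq_diff_right form_pq_sum_right form_pq_scale_right)
      next
        case False
        then show ?thesis using matrix_pow_eq_0_mono[OF v(2)] by simp
      qed
      moreover have "?y \<in> W"
        using that v(1) invp sub by (intro vec.subspace_diff vec.subspace_sum vec.subspace_scale) auto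
      ultimately show ?thesis unfolding W'_def by blast
    qed
    have nondeg': "x = 0" if "x \<in> W'" "\<And>y. y \<in> W' \<Longrightarrow> form_pq y x = 0" for x
    proof (rule nondeg)
      show "x \<in> W" using that W'_def by blast
      fix y assume "y \<in> W"
      then obtain c where c: "y - (\<Sum>i<d. c i *s (matrix_pow X i *v v)) \<in> W'" using decomp by blast
      have "form_pq (\<Sum>i<d. c i *s (matrix_pow X i *v v)) x = 0"
        using that(1) by (simp add: form_pq_sum_left form_pq_scale_left W'_def)
      then show "form_pq y x = 0" using that(2)[OF c] by (simp add: form_pq_diff_left)
    qed
    have sub': "W' \<subseteq> W" by (auto simp: W'_def)
    \<comment> \<open>X^(d-1) v pairs nontrivially with v itself, so the complement is proper and
      the dimension drops.\<close>
    have "matrix_pow X (d - 1) *v v \<notin> W'"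
      using gram[of 0 "d - 1"] d by (auto simp: W'_def intro!: exI[of _ 0])
    then have "W' \<noteq> W" using invp[OF v(1)] by blast
    then have "vec.dim W' < vec.dim W"
      using vec.subspace_dim_equal[OF W' sub sub'] vec.dim_subset[OF sub'] by linarith
    from less.hyps[OF this W' invW' nondeg']
    obtain ds w where IH: "orthogonal_chains X ds w" "vec.span (chain_vectors X ds w) = W'" by blast
    have w: "w j \<in> W'" if "j < length ds" for j
    proof -
      have "ds ! j > 0" using IH(1) that by (auto simp: orthogonal_chains_def)
      then have "matrix_pow X 0 *v w j \<in> chain_vectors X ds w"
        unfolding chain_vectors_def using that by (intro image_eqI[of _ _ "(j, 0)"]) auto
      then show ?thesis using vec.span_base IH(2) by fastforce
    qed
    have vw: "form_pq v (matrix_pow X a *v w j) = 0" if "j < length ds" for a j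
      using invpW'[OF w[OF that], of a] by (auto simp: W'_def dest!: spec[of _ 0])
    have wv: "form_pq (w j) (matrix_pow X a *v v) = 0" if "j < length ds" for a j
      using skew_pq_pow_cnj[OF assms(1), of "w j" a v] vw[OF that] by simp
    have "orthogonal_chains X (ds @ [d]) (w(length ds := v))"
      using IH(1) d v(2) orth norm vw wv unfolding orthogonal_chains_def
      by (simp add: less_Suc_eq nth_append all_conj_distrib imp_conjL ball_Un)
    moreover have "vec.span (chain_vectors X (ds @ [d]) (w(length ds := v))) = W"
    proof
      have "matrix_pow X i *v v \<in> W" for i using invp v by blast
      moreover have "chain_vectors X ds w \<subseteq> W" using IH(2) vec.span_superset sub' by blast
      ultimately show "vec.span (chain_vectors X (ds @ [d]) (w(length ds := v))) \<subseteq> W"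
        unfolding chain_vectors_snoc by (intro vec.span_minimal sub) auto
      show "W \<subseteq> vec.span (chain_vectors X (ds @ [d]) (w(length ds := v)))" (is "_ \<subseteq> ?S")
      proof
        fix x assume "x \<in> W"
        then obtain c where c: "x - (\<Sum>i<d. c i *s (matrix_pow X i *v v)) \<in> W'" using decomp by blast
        then have "x - (\<Sum>i<d. c i *s (matrix_pow X i *v v)) \<in> ?S"
          unfolding chain_vectors_snoc using IH(2) vec.span_mono by blast
        moreover have "(\<Sum>i<d. c i *s (matrix_pow X i *v v)) \<in> ?S"
          unfolding chain_vectors_snoc
          by (intro vec.span_sum vec.span_scale vec.span_base) auto
        ultimately show "x \<in> ?S" using vec.span_add by force
      qed
    qed
    ultimately show ?thesis by blast
  qed
qed

section \<open>The Jordan partition and the signature bound\<close>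

lemma matrix_pow_chain_span:
  assumes "jordan_chain_basis X ds w"
  shows "range ((*v) (matrix_pow X k)) =
     vec.span ((\<lambda>(j, i). matrix_pow X i *v w j) ` {(j, i). j < length ds \<and> i < ds ! j \<and> k \<le> i})"
    (is "_ = vec.span (?u ` ?K)")
proof -
  let ?J = "{(j, i). j < length ds \<and> i < ds ! j}"
  have shift: "matrix_pow X k *v ?u (j, i) = ?u (j, k + i)" for j i
    by (simp add: matrix_pow_add_vec)
  have zero: "?u (j, i) = 0" if "j < length ds" "ds ! j \<le> i" for j i
    using assms that matrix_pow_eq_0_mono by (fastforce simp: jordan_chain_basis_def Let_def)
  have "range ((*v) (matrix_pow X k)) = (*v) (matrix_pow X k) ` vec.span (?u ` ?J)"
    using assms by (simp add: jordan_chain_basis_def Let_def)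
  also have "\<dots> = vec.span ((*v) (matrix_pow X k) ` ?u ` ?J)"
    by (rule vec.span_image[symmetric])
  also have "\<dots> = vec.span (?u ` ?K)"
  proof (rule vec.span_eq[THEN iffD2], intro conjI subsetI)
    fix x assume "x \<in> (*v) (matrix_pow X k) ` ?u ` ?J"
    then obtain j i where ji: "j < length ds" "i < ds ! j" "x = ?u (j, k + i)"
      using shift by auto
    show "x \<in> vec.span (?u ` ?K)"
    proof (cases "k + i < ds ! j")
      case True
      then show ?thesis using ji by (intro vec.span_base image_eqI[of _ _ "(j, k + i)"]) auto
    next
      case False
      then show ?thesis using ji zero[of j "k + i"] by (simp add: vec.span_zero)
    qed
  next
    fix x assume "x \<in> ?u ` ?K"
    then obtain j i where ji: "j < length ds" "i < ds ! j" "k \<le> i" "x = ?u (j, i)" by auto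
    then have "x = matrix_pow X k *v ?u (j, i - k)" using shift[of j "i - k"] by simp
    moreover have "?u (j, i - k) \<in> ?u ` ?J" using ji by (intro imageI) simp
    ultimately have "x \<in> (*v) (matrix_pow X k) ` ?u ` ?J" by blast
    then show "x \<in> vec.span ((*v) (matrix_pow X k) ` ?u ` ?J)" by (rule vec.span_base)
  qed
  finally show ?thesis .
qed

text \<open>X^k pushes every chain up by k, so a block of size d keeps d - k vectors; truncated
  subtraction makes this 0 for d at most k.\<close>

lemma jordan_chain_basis_rank:
  assumes "jordan_chain_basis X ds w"
  shows "vec.dim (range ((*v) (matrix_pow X k))) = (\<Sum>d\<leftarrow>ds. d - k)"
proof -
  let ?u = "\<lambda>(j, i). matrix_pow X i *v w j"
  let ?J = "{(j, i). j < length ds \<and> i < ds ! j}"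
  let ?K = "{(j, i). j < length ds \<and> i < ds ! j \<and> k \<le> i}"
  have KJ: "?K \<subseteq> ?J" by auto
  have J: "inj_on ?u ?J" "vec.independent (?u ` ?J)"
    using assms by (simp_all add: jordan_chain_basis_def Let_def)
  have "vec.dim (range ((*v) (matrix_pow X k))) = card (?u ` ?K)"
    unfolding matrix_pow_chain_span[OF assms]
    by (rule vec.dim_span_eq_card_independent[OF vec.independent_mono[OF J(2) image_mono[OF KJ]]])
  also have "\<dots> = card ?K"
    using card_image inj_on_subset[OF J(1) KJ] by blast
  also have "?K = (SIGMA j:{..<length ds}. {k..<ds ! j})" by auto
  also have "card \<dots> = (\<Sum>d\<leftarrow>ds. d - k)"
    by (simp add: sum_list_sum_nth atLeast0LessThan)
  finally show ?thesis .
qed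

lemma sum_list_diff_Suc:
  "(\<Sum>d\<leftarrow>ds. d - k) = (\<Sum>d\<leftarrow>ds. d - Suc k) + length (filter (\<lambda>d. k < d) ds)"
  by (induction ds) auto

lemma length_filter_greater:
  "length (filter (\<lambda>d. k < d) ds) = length (filter (\<lambda>d. Suc k < d) ds) + count (mset ds) (Suc k)"
  by (induction ds) auto

text \<open>The ranks of the powers determine the block sizes: first differences count the blocks
  larger than k, second differences those of size k + 1.\<close>

lemma jordan_chain_basis_unique:
  assumes "jordan_chain_basis X ds w" "jordan_chain_basis X ds' w'"
  shows "mset ds = mset ds'"
proof (rule multiset_eqI)
  fix d
  have S: "(\<Sum>d\<leftarrow>ds. d - k) = (\<Sum>d\<leftarrow>ds'. d - k)" for k
    using jordan_chain_basis_rank assms by metis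
  have "length (filter (\<lambda>d. k < d) ds) = length (filter (\<lambda>d. k < d) ds')" for k
    using S[of k] S[of "Suc k"] sum_list_diff_Suc[of k ds] sum_list_diff_Suc[of k ds'] by linarith
  then have "count (mset ds) (Suc k) = count (mset ds') (Suc k)" for k
    using length_filter_greater[of k ds] length_filter_greater[of k ds'] by (metis add_left_cancel)
  \<comment> \<open>Second differences see only positive sizes; size 0 is excluded by the definition
    of a chain basis.\<close>
  moreover have "count (mset ds) 0 = 0" "count (mset ds') 0 = 0"
    using assms by (auto simp: jordan_chain_basis_def Let_def count_eq_zero_iff)
  ultimately show "count (mset ds) d = count (mset ds') d" by (cases d) metis+
qed

lemma jordan_partition_eq:
  assumes "jordan_chain_basis X ds w"
  shows "jordan_partition X = mset ds"
  unfolding jordan_partition_def using assms jordan_chain_basis_unique by blast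

section \<open>Real invariant subspaces and the inclusion of M(d - 1) in ker X^d\<close>

lemma linear_matrix_vector: "linear ((*v) (A :: complex^'n^'m))"
  by (rule linearI) (simp_all add: matrix_vector_right_distrib scaleR_eq_scalar_mult vec.scale)

text \<open>A nilpotent map properly shrinks every nonzero invariant subspace, so each application
  lowers the real dimension by at least one.\<close>

lemma nilpotent_on_real_subspace:
  fixes X :: "complex^'n^'n"
  assumes "\<And>x. matrix_pow X N *v x = 0"
    and "subspace W" "\<And>x. x \<in> W \<Longrightarrow> X *v x \<in> W" "dim W \<le> n" "x \<in> W"
  shows "matrix_pow X n *v x = 0"
  using assms(2-)
proof (induction n arbitrary: W x)
  case 0
  then show ?case by (simp add: subset_singleton_iff) blast
next
  case (Suc n)
  let ?XW = "(*v) X ` W"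
  have XW: "subspace ?XW" by (rule linear_subspace_image[OF linear_matrix_vector Suc.prems(1)])
  have sub: "?XW \<subseteq> W" using Suc.prems by blast
  have "dim ?XW \<le> n"
  proof (cases "?XW = W")
    case True
    \<comment> \<open>If X maps \<open>W\<close> onto itself, so do all its powers, and a vanishing
      power leaves only 0.\<close>
    have "x \<in> (*v) (matrix_pow X k) ` W" if "x \<in> W" for x k
      using that
    proof (induction k arbitrary: x)
      case (Suc k)
      then obtain y where y: "x = X *v y" "y \<in> W" using True by blast
      obtain z where "y = matrix_pow X k *v z" "z \<in> W" using Suc.IH[OF y(2)] by blast
      then show ?case using y by (auto simp: matrix_pow_Suc_vec)
    qed simp
    then have "W \<subseteq> {0}" using assms(1) by (metis imageE singletonI subsetI)
    then show ?thesis using True by (metis dim_eq_0 zero_le)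
  next
    case False
    then have "dim ?XW \<noteq> dim W" using subspace_dim_equal[OF XW Suc.prems(1) sub] by auto
    then show ?thesis using dim_subset[OF sub] Suc.prems(3) by linarith
  qed
  then have "matrix_pow X n *v (X *v x) = 0"
    using Suc.IH[OF XW] sub Suc.prems by blast
  then show ?case by (simp add: matrix_pow_Suc_vec')
qed

text \<open>A submodule of real dimension k + 1 is in particular X-invariant, so the dimension count
  applies to it. \<open>H\<close> and \<open>Y\<close> are arbitrary here, so the inclusion is
  available for every triple over which \<open>p_mult\<close> quantifies.\<close>

lemma M_space_subset_kernel:
  fixes X :: "complex^'n^'n"
  assumes "\<And>x. matrix_pow X N *v x = 0"
  shows "M_space X H Y k \<subseteq> {x. matrix_pow X (Suc k) *v x = 0}"
  unfolding M_space_def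
proof (rule span_minimal)
  show "subspace {x. matrix_pow X (Suc k) *v x = 0}"
    using linear_subspace_kernel[OF linear_matrix_vector] .
  show "\<Union>{W. irreducible_submodule {X, H, Y} W \<and> dim W = k + 1} \<subseteq> {x. matrix_pow X (Suc k) *v x = 0}"
  proof clarify
    fix x W assume W: "irreducible_submodule {X, H, Y} W" "dim W = k + 1" "x \<in> W"
    then have "subspace W" "\<And>x. x \<in> W \<Longrightarrow> X *v x \<in> W"
      by (auto simp: irreducible_submodule_def real_submodule_def span_base)
    from nilpotent_on_real_subspace[OF assms this _ W(3)] W(2)
    show "matrix_pow X (Suc k) *v x = 0" by simp
  qed
qed

section \<open>Gram matrix, dual basis and radical in an orthogonal chain basis\<close>

locale orthogonal_chain_basis =
  fixes X :: "complex^('p::finite + 'q::finite)^('p + 'q)" and ds w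
  assumes skew: "skew_pq X"
    and chains: "orthogonal_chains X ds w"
    and spanning: "vec.span (chain_vectors X ds w) = UNIV"
begin

abbreviation u where "u j i \<equiv> matrix_pow X i *v w j"

abbreviation J where "J \<equiv> {(j, i). j < length ds \<and> i < ds ! j}"

lemma finite_J: "finite J"
proof -
  have "J = (SIGMA j:{..<length ds}. {..<ds ! j})" by auto
  then show ?thesis by simp
qed

lemma part_pos: "j < length ds \<Longrightarrow> 0 < ds ! j"
  using chains by (auto simp: orthogonal_chains_def)

lemma u_eq_0: "j < length ds \<Longrightarrow> ds ! j \<le> i \<Longrightarrow> u j i = 0"
  by (rule matrix_pow_eq_0_mono[of _ "ds ! j"]) (use chains in \<open>auto simp: orthogonal_chains_def\<close>)

lemma pow_u: "matrix_pow X a *v u j i = u j (a + i)"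
  by (simp add: matrix_pow_add_vec)

lemma gram_sign:
  "j < length ds \<Longrightarrow> form_pq (w j) (u j (ds ! j - 1)) \<in> unit_signs (ds ! j)"
  using chains unfolding orthogonal_chains_def by blast

lemma gram:
  assumes "j < length ds" "k < length ds"
  shows "form_pq (u j i) (u k l) =
    (if j = k \<and> Suc (i + l) = ds ! j then (-1) ^ i * form_pq (w j) (u j (ds ! j - 1)) else 0)"
proof -
  have "form_pq (w j) (u k (i + l)) = 0" if "\<not> (j = k \<and> Suc (i + l) = ds ! j)"
    using chains assms that unfolding orthogonal_chains_def by blast
  moreover have "i + l = ds ! j - 1" if "Suc (i + l) = ds ! j" using that by simp
  ultimately show ?thesis by (auto simp: skew_pq_pow_both[OF skew])
qed

lemma gram_nonzero: "j < length ds \<Longrightarrow> Suc (i + l) = ds ! j \<Longrightarrow> form_pq (u j i) (u j l) \<noteq> 0"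
  using unit_signs_nonzero[OF gram_sign] by (simp add: gram)

lemma orthogonal_to_basis_eq_0:
  assumes "\<And>j i. j < length ds \<Longrightarrow> i < ds ! j \<Longrightarrow> form_pq (u j i) x = 0"
  shows "x = 0"
proof (rule form_pq_nondegenerate)
  fix y
  have "y \<in> vec.span (chain_vectors X ds w)" using spanning by simp
  then show "form_pq y x = 0"
    by (induction rule: vec.span_induct_alt)
      (auto simp: chain_vectors_def form_pq_add_left form_pq_scale_left assms)
qed

lemma form_sum_J:
  assumes "k < length ds" "l < ds ! k"
  shows "form_pq (u k l) (\<Sum>(j, i)\<in>J. c j i *s u j i) =
    c k (ds ! k - Suc l) * form_pq (u k l) (u k (ds ! k - Suc l))"
proof -
  have "form_pq (u k l) (\<Sum>(j, i)\<in>J. c j i *s u j i) = (\<Sum>(j, i)\<in>J. c j i * form_pq (u k l) (u j i))"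
    by (simp add: form_pq_sum_right case_prod_unfold form_pq_scale_right)
  also have "\<dots> = (\<Sum>(j, i)\<in>{(k, ds ! k - Suc l)}. c j i * form_pq (u k l) (u j i))"
    by (rule sum.mono_neutral_right[OF finite_J]) (use assms in \<open>auto simp: gram split: if_splits\<close>)
  finally show ?thesis by simp
qed

text \<open>The chain basis is its own dual up to order and scale: the only basis vector that pairs
  with \<open>u j i\<close> is \<open>u j (ds ! j - Suc i)\<close>.\<close>

lemma expansion:
  "x = (\<Sum>(j, i)\<in>J. (form_pq (u j (ds ! j - Suc i)) x / form_pq (u j (ds ! j - Suc i)) (u j i)) *s u j i)"
    (is "x = ?S")
proof -
  have "x - ?S = 0"
  proof (rule orthogonal_to_basis_eq_0)
    fix k l assume kl: "k < length ds" "l < ds ! k"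
    then have "form_pq (u k l) (u k (ds ! k - Suc l)) \<noteq> 0" by (intro gram_nonzero) auto
    then show "form_pq (u k l) (x - ?S) = 0"
      unfolding form_pq_diff_right form_sum_J[OF kl]
      using kl by (simp add: Suc_diff_Suc)
  qed
  then show ?thesis by simp
qed

lemma in_span_basis:
  assumes "K \<subseteq> J" "\<And>j i. (j, i) \<in> J - K \<Longrightarrow> form_pq (u j (ds ! j - Suc i)) x = 0"
  shows "x \<in> vec.span ((\<lambda>(j, i). u j i) ` K)"
proof -
  have "(\<Sum>(j, i)\<in>J. (form_pq (u j (ds ! j - Suc i)) x / form_pq (u j (ds ! j - Suc i)) (u j i)) *s u j i)
     \<in> vec.span ((\<lambda>(j, i). u j i) ` K)"
  proof (rule vec.span_sum, clarify)
    fix j i assume "j < length ds" "i < ds ! j"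
    then show "(form_pq (u j (ds ! j - Suc i)) x / form_pq (u j (ds ! j - Suc i)) (u j i)) *s u j i
       \<in> vec.span ((\<lambda>(j, i). u j i) ` K)"
      using assms(2)[of j i] by (cases "(j, i) \<in> K")
        (auto intro!: vec.span_scale vec.span_zero intro: vec.span_base)
  qed
  then show ?thesis using expansion by simp
qed

lemma basis_independent:
  "inj_on (\<lambda>(j, i). u j i) J" "vec.independent ((\<lambda>(j, i). u j i) ` J)"
proof -
  have *: "\<forall>k\<in>J. c k = 0" if "(\<Sum>k\<in>J. c k *s (case k of (j, i) \<Rightarrow> u j i)) = 0" for c
  proof clarify
    fix j i assume ji: "j < length ds" "i < ds ! j"
    have "(\<Sum>(j, i)\<in>J. c (j, i) *s u j i) = 0"
      using that by (simp add: case_prod_unfold)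
    then have "c (j, i) * form_pq (u j (ds ! j - Suc i)) (u j i) = 0"
      using form_sum_J[of j "ds ! j - Suc i" "\<lambda>j i. c (j, i)"] ji by (simp add: Suc_diff_Suc)
    then show "c (j, i) = 0"
      using gram_nonzero[of j "ds ! j - Suc i" i] ji by auto
  qed
  show "inj_on (\<lambda>(j, i). u j i) J" "vec.independent ((\<lambda>(j, i). u j i) ` J)"
    using independent_familyI[OF finite_J *] by blast+
qed

lemma jordan_basis: "jordan_chain_basis X ds w"
  using chains spanning basis_independent
  unfolding jordan_chain_basis_def orthogonal_chains_def chain_vectors_def Let_def by blast

lemma partition_eq: "jordan_partition X = mset ds"
  by (rule jordan_partition_eq[OF jordan_basis])

definition parts_of_size where "parts_of_size d = {j. j < length ds \<and> ds ! j = d}"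

lemma finite_parts_of_size [simp]: "finite (parts_of_size d)"
  by (simp add: parts_of_size_def)

lemma card_parts_of_size: "card (parts_of_size d) = count (jordan_partition X) d"
  unfolding partition_eq parts_of_size_def
  by (simp add: count_mset count_list_eq_length_filter length_filter_conv_card eq_commute)

text \<open>The radical on ker X^d is cut out by only t_d linear conditions. Expand z in the chain
  basis. Vectors of ker X^d are orthogonal to the image of X^d; this removes the coefficients of z
  with i + d < ds ! j and, for i > 0, the products with r. For i + d > ds ! j the vector
  \<open>u j i\<close> is killed by X^(d-1). What remains is i = 0 in chains of length d, where the
  last hypothesis applies.\<close>

lemma kernel_form_radical:
  assumes "d > 0" "matrix_pow X d *v z = 0" "matrix_pow X d *v r = 0"
    and "\<And>j. j \<in> parts_of_size d \<Longrightarrow> form_pq (u j (d - 1)) r = 0"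
  shows "form_pq z (matrix_pow X (d - 1) *v r) = 0"
proof -
  have ker: "form_pq (u j i) x = 0" if "matrix_pow X d *v x = 0" "d \<le> i" for i j x
    using that skew_pq_pow_left[OF skew, of d "u j (i - d)" x] by (simp add: pow_u)
  let ?c = "\<lambda>j i. form_pq (u j (ds ! j - Suc i)) z / form_pq (u j (ds ! j - Suc i)) (u j i)"
  have "form_pq z (matrix_pow X (d - 1) *v r) =
      (\<Sum>(j, i)\<in>J. cnj (?c j i) * form_pq (u j i) (matrix_pow X (d - 1) *v r))"
    by (subst expansion[of z]) (simp add: form_pq_sum_left case_prod_unfold form_pq_scale_left)
  also have "\<dots> = 0"
  proof (rule sum.neutral, clarify)
    fix j i assume ji: "j < length ds" "i < ds ! j"
    have eq: "form_pq (u j i) (matrix_pow X (d - 1) *v r) = (-1) ^ (d - 1) * form_pq (u j (d - 1 + i)) r"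
      using skew_pq_pow_left[OF skew, of "d - 1" "u j i" r] by (simp add: pow_u)
    consider "i + d < ds ! j" | "ds ! j < i + d" | "i + d = ds ! j" "i > 0" | "i = 0" "ds ! j = d"
      by linarith
    then show "cnj (?c j i) * form_pq (u j i) (matrix_pow X (d - 1) *v r) = 0"
    proof cases
      case 1
      then have "form_pq (u j (ds ! j - Suc i)) z = 0" by (intro ker assms) simp
      then show ?thesis by simp
    next
      case 2
      then have "u j (d - 1 + i) = 0" using ji by (intro u_eq_0) auto
      then show ?thesis unfolding eq by simp
    next
      case 3
      then have "form_pq (u j (d - 1 + i)) r = 0" using assms(1) by (intro ker assms) simp
      then show ?thesis unfolding eq by simp
    next
      case 4
      then have "form_pq (u j (d - 1)) r = 0" using ji by (intro assms) (simp add: parts_of_size_def)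
      then show ?thesis unfolding eq using 4 by simp
    qed
  qed
  finally show ?thesis .
qed

text \<open>A form-theoretic Sylvester law: modulo its radical, the form \<open>\<langle>x, X\<^sup>d\<^sup>-\<^sup>1 y\<rangle>\<close> on
  \<open>ker X\<^sup>d\<close> lives on a space whose dimension is the multiplicity of \<open>d\<close>, so a positive and
  a negative definite family together cannot have more members than that.\<close>

lemma signature_bound:
  fixes x :: "'a \<Rightarrow> complex^('p + 'q)" and y :: "'b \<Rightarrow> complex^('p + 'q)"
  assumes "d > 0" "finite A" "finite B"
    and kx: "\<And>a. a \<in> A \<Longrightarrow> matrix_pow X d *v x a = 0"
    and ky: "\<And>b. b \<in> B \<Longrightarrow> matrix_pow X d *v y b = 0"
    and fx: "\<And>a a'. a \<in> A \<Longrightarrow> a' \<in> A \<Longrightarrow>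
       s * form_pq (x a) (matrix_pow X (d - 1) *v x a') = (if a = a' then 1 else 0)"
    and fy: "\<And>b b'. b \<in> B \<Longrightarrow> b' \<in> B \<Longrightarrow>
       s * form_pq (y b) (matrix_pow X (d - 1) *v y b') = (if b = b' then -1 else 0)"
  shows "card A + card B \<le> count (jordan_partition X) d"
proof -
  let ?T = "parts_of_size d"
  \<comment> \<open>A disjoint sum, since the two index sets may overlap; in
    \<open>real_imp_balanced\<close> they coincide.\<close>
  let ?I = "A <+> B"
  \<comment> \<open>\<open>\<Phi>\<close> bundles the t_d conditions defining the radical into one
    linear map with values in the span of t_d vectors. Independence of the images of the two
    families then bounds their number.\<close>
  define \<Phi> where "\<Phi> = (\<lambda>r. \<Sum>j\<in>?T. form_pq (u j (d - 1)) r *s w j)"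
  define f where "f = case_sum x y"
  have \<Phi>_sum: "\<Phi> (\<Sum>k\<in>K. c k *s g k) = (\<Sum>k\<in>K. c k *s \<Phi> (g k))"
    for K and c :: "'a + 'b \<Rightarrow> complex" and g
  proof -
    have "\<Phi> (\<Sum>k\<in>K. c k *s g k) = (\<Sum>j\<in>?T. \<Sum>k\<in>K. (c k * form_pq (u j (d - 1)) (g k)) *s w j)"
      by (simp add: \<Phi>_def form_pq_sum_right form_pq_scale_right vec.scale_sum_left)
    also have "\<dots> = (\<Sum>k\<in>K. c k *s \<Phi> (g k))"
      by (subst sum.swap) (simp add: \<Phi>_def vec.scale_sum_right)
    finally show ?thesis .
  qed
  let ?B = "\<lambda>x y. form_pq x (matrix_pow X (d - 1) *v y)"
  have indep: "\<forall>k\<in>?I. c k = 0" if c0: "(\<Sum>k\<in>?I. c k *s \<Phi> (f k)) = 0" for c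
  proof -
    define p where "p = (\<Sum>a\<in>A. c (Inl a) *s x a)"
    define q where "q = (\<Sum>b\<in>B. c (Inr b) *s y b)"
    have pq: "(\<Sum>k\<in>?I. c k *s f k) = p + q"
      using assms(2,3) by (simp add: p_def q_def f_def sum.Plus)
    have \<Phi>0: "\<Phi> (p + q) = 0" using c0 \<Phi>_sum[of c f ?I] pq by simp
    have kp: "matrix_pow X d *v p = 0" and kq: "matrix_pow X d *v q = 0"
      by (simp_all add: p_def q_def vec.sum vec.scale kx ky)
    have r0: "form_pq (u j (d - 1)) (p + q) = 0" if j: "j \<in> ?T" for j
    proof -
      have jd: "j < length ds" "ds ! j = d" using j by (auto simp: parts_of_size_def)
      have "0 = form_pq (u j (d - 1)) (\<Phi> (p + q))" using \<Phi>0 by simp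
      also have "\<dots> = (\<Sum>k\<in>?T. form_pq (u k (d - 1)) (p + q) * form_pq (u j (d - 1)) (u k 0))"
        by (simp add: \<Phi>_def form_pq_sum_right form_pq_scale_right)
      also have "\<dots> = (\<Sum>k\<in>{j}. form_pq (u k (d - 1)) (p + q) * form_pq (u j (d - 1)) (u k 0))"
      proof (rule sum.mono_neutral_right)
        show "\<forall>k\<in>?T - {j}. form_pq (u k (d - 1)) (p + q) * form_pq (u j (d - 1)) (u k 0) = 0"
          using jd gram[of j _ "d - 1" 0] by (auto simp: parts_of_size_def)
      qed (use j in auto)
      finally show ?thesis
        using gram_nonzero[of j "d - 1" 0] jd \<open>d > 0\<close> by simp
    qed
    have rad: "?B z (p + q) = 0" if "matrix_pow X d *v z = 0" for z
      by (rule kernel_form_radical[OF \<open>d > 0\<close> that _ r0])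
        (simp_all add: matrix_vector_right_distrib kp kq)
    have "?B p p + ?B p q = 0" using rad[OF kp] by (simp add: matrix_vector_right_distrib form_pq_add_right)
    moreover have "?B (p + q) q = 0"
      using skew_pq_pow_cnj[OF skew, of "p + q" "d - 1" q] rad[OF kq] by simp
    then have "?B p q + ?B q q = 0" by (simp add: form_pq_add_left)
    \<comment> \<open>As p + q lies in the radical, both squares equal - \<open>?B p q\<close>.
      Multiplied by \<open>s\<close>, one is nonnegative and the other nonpositive, so all
      coefficients vanish.\<close>
    ultimately have pp_qq: "?B p p = ?B q q" by (metis add.commute add_left_cancel)
    have norm_sq: "cnj z * z = of_real ((cmod z)\<^sup>2)" for z
      by (metis complex_norm_square mult.commute)
    have "s * ?B p p = (\<Sum>a\<in>A. \<Sum>a'\<in>A. cnj (c (Inl a)) * c (Inl a') * (s * ?B (x a) (x a')))"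
      unfolding p_def form_pq_sum_left vec.sum form_pq_sum_right
      by (subst sum.swap)
        (simp add: vec.scale form_pq_scale_left form_pq_scale_right sum_distrib_left mult_ac)
    also have "\<dots> = (\<Sum>a\<in>A. \<Sum>a'\<in>A. if a = a' then of_real ((cmod (c (Inl a)))\<^sup>2) else 0)"
      by (intro sum.cong) (simp_all add: fx norm_sq del: One_nat_def of_real_power)
    also have "\<dots> = of_real (\<Sum>a\<in>A. (cmod (c (Inl a)))\<^sup>2)" using \<open>finite A\<close> by simp
    finally have P: "s * ?B p p = of_real (\<Sum>a\<in>A. (cmod (c (Inl a)))\<^sup>2)" .
    have "s * ?B q q = (\<Sum>b\<in>B. \<Sum>b'\<in>B. cnj (c (Inr b)) * c (Inr b') * (s * ?B (y b) (y b')))"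
      unfolding q_def form_pq_sum_left vec.sum form_pq_sum_right
      by (subst sum.swap)
        (simp add: vec.scale form_pq_scale_left form_pq_scale_right sum_distrib_left mult_ac)
    also have "\<dots> = (\<Sum>b\<in>B. \<Sum>b'\<in>B. if b = b' then - of_real ((cmod (c (Inr b)))\<^sup>2) else 0)"
      by (intro sum.cong) (simp_all add: fy norm_sq del: One_nat_def of_real_power)
    also have "\<dots> = of_real (- (\<Sum>b\<in>B. (cmod (c (Inr b)))\<^sup>2))" using \<open>finite B\<close> by (simp add: sum_negf)
    finally have Q: "s * ?B q q = of_real (- (\<Sum>b\<in>B. (cmod (c (Inr b)))\<^sup>2))" .
    have "(\<Sum>a\<in>A. (cmod (c (Inl a)))\<^sup>2) = - (\<Sum>b\<in>B. (cmod (c (Inr b)))\<^sup>2)"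
      using P Q pp_qq of_real_eq_iff[where 'a = complex] by metis
    moreover have "(\<Sum>a\<in>A. (cmod (c (Inl a)))\<^sup>2) \<ge> 0" "(\<Sum>b\<in>B. (cmod (c (Inr b)))\<^sup>2) \<ge> 0"
      by (simp_all add: sum_nonneg)
    ultimately have "(\<Sum>a\<in>A. (cmod (c (Inl a)))\<^sup>2) = 0" "(\<Sum>b\<in>B. (cmod (c (Inr b)))\<^sup>2) = 0"
      by linarith+
    then show ?thesis using assms(2,3) by (auto simp: sum_nonneg_eq_0_iff)
  qed
  have fin: "finite ?I" using assms(2,3) by simp
  note ind = independent_familyI[where f = "\<lambda>k. \<Phi> (f k)", OF fin indep]
  have "card A + card B = card ?I" using assms(2,3) by (simp add: card_Plus)
  also have "\<dots> = card ((\<lambda>k. \<Phi> (f k)) ` ?I)" using card_image[OF ind(1)] by simp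
  also have "\<dots> \<le> card (w ` ?T)"
  proof -
    have "(\<lambda>k. \<Phi> (f k)) ` ?I \<subseteq> vec.span (w ` ?T)"
      unfolding \<Phi>_def by (intro image_subsetI vec.span_sum vec.span_scale vec.span_base) auto
    then show ?thesis using vec.independent_span_bound[OF _ ind(2)] by simp
  qed
  also have "\<dots> \<le> card ?T" by (rule card_image_le) simp
  finally show ?thesis by (simp add: card_parts_of_size)
qed

end

lemma orthogonal_chain_basis_exists:
  assumes "skew_pq X" "nilpotent_matrix X"
  shows "\<exists>ds w. orthogonal_chain_basis X ds w"
proof -
  obtain N where "matrix_pow X N = 0"
    using assms(2) by (auto simp: nilpotent_matrix_def)
  then have "matrix_pow X N *v x = 0" for x by simp
  from orthogonal_chains_exist_on[OF assms(1) this, of UNIV] form_pq_nondegenerate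
  show ?thesis using assms(1) by (auto simp: orthogonal_chain_basis_def)
qed

section \<open>Adapted \<open>sl\<^sub>2\<close>-triples\<close>

text \<open>Subtracting the eigenvalue at \<open>a\<close> from H removes one component and rescales
  the others by nonzero factors. Scalars stay real because submodules are real subspaces; components
  are allowed to be zero.\<close>

lemma eigenvector_components_in_subspace:
  fixes H :: "complex^'n^'n" and lam :: "'k \<Rightarrow> real"
  assumes "finite E" "subspace U" "\<And>x. x \<in> U \<Longrightarrow> H *v x \<in> U"
    and "\<And>e. e \<in> E \<Longrightarrow> H *v f e = lam e *\<^sub>R f e" "inj_on lam E" "sum f E \<in> U" "e \<in> E"
  shows "f e \<in> U"
  using assms(1,4-7)
proof (induction E arbitrary: f e rule: finite_induct)
  case (insert a E)
  have "H *v sum f (insert a E) - lam a *\<^sub>R sum f (insert a E) =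
      (\<Sum>e\<in>insert a E. (lam e - lam a) *\<^sub>R f e)"
    using insert.prems(1)
    by (simp add: vec.sum scaleR_right.sum sum_subtractf scaleR_diff_left del: sum.insert)
  also have "\<dots> = (\<Sum>e\<in>E. (lam e - lam a) *\<^sub>R f e)"
    using insert.hyps by simp
  finally have "(\<Sum>e\<in>E. (lam e - lam a) *\<^sub>R f e) \<in> U"
    using assms(2,3) insert.prems(3) subspace_diff subspace_scale by metis
  moreover have "H *v ((lam e - lam a) *\<^sub>R f e) = lam e *\<^sub>R ((lam e - lam a) *\<^sub>R f e)" if "e \<in> E" for e
    using that insert.prems(1) by (simp add: linear_scale[OF linear_matrix_vector])
  ultimately have *: "(lam e - lam a) *\<^sub>R f e \<in> U" if "e \<in> E" for e
    using insert.IH[of "\<lambda>e. (lam e - lam a) *\<^sub>R f e"] that insert.prems(2) by simp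
  have E: "f e \<in> U" if "e \<in> E" for e
  proof -
    have "lam e - lam a \<noteq> 0" using insert.prems(2) insert.hyps that by (auto simp: inj_on_def)
    then show ?thesis using subspace_scale[OF assms(2) *[OF that], of "1 / (lam e - lam a)"] by simp
  qed
  have "f a = sum f (insert a E) - sum f E" using insert.hyps by simp
  also have "\<dots> \<in> U"
    by (intro subspace_diff assms(2) subspace_sum E insert.prems(3))
  finally show ?case using E insert.prems(4) by blast
qed simp

lemma real_submodule_triple_iff:
  "real_submodule {X, H, Y} W \<longleftrightarrow>
     subspace W \<and> (\<forall>x\<in>W. X *v x \<in> W \<and> H *v x \<in> W \<and> Y *v x \<in> W)"
proof
  assume "real_submodule {X, H, Y} W"
  then show "subspace W \<and> (\<forall>x\<in>W. X *v x \<in> W \<and> H *v x \<in> W \<and> Y *v x \<in> W)"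
    by (auto simp: real_submodule_def span_base)
next
  assume W: "subspace W \<and> (\<forall>x\<in>W. X *v x \<in> W \<and> H *v x \<in> W \<and> Y *v x \<in> W)"
  have "Z *v x \<in> W" if "Z \<in> span {X, H, Y}" "x \<in> W" for Z x
    using that(1)
  proof (induction rule: span_induct_alt)
    case base
    then show ?case using W by (simp add: subspace_0)
  next
    case (step c A B)
    then have "A *v x \<in> W" using W that(2) by auto
    then show ?case using step W
      by (simp add: matrix_vector_mult_add_rdistrib scaleR_matrix_vector_mult subspace_add subspace_scale)
  qed
  then show "real_submodule {X, H, Y} W" using W by (simp add: real_submodule_def)
qed

text \<open>The irreducible sl2-module of dimension d in coordinates, with X raising from the lowest
  weight 1 - d. The factor i (d - i) is forced by [X, Y] = H: it is minus the sum of the weights 2k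
  + 1 - d over k < i. At i = 0 it is 0, so the truncated \<open>i - 1\<close> is harmless.\<close>

locale lowest_weight_vector =
  fixes X H Y :: "complex^'n^'n" and y d
  assumes d_pos: "d > 0" and nonzero: "y \<noteq> 0" and pow_d: "matrix_pow X d *v y = 0"
    and H_weight: "\<And>i. i < d \<Longrightarrow>
      H *v (matrix_pow X i *v y) = (2 * real i + 1 - real d) *\<^sub>R (matrix_pow X i *v y)"
    and Y_lower: "\<And>i. i < d \<Longrightarrow>
      Y *v (matrix_pow X i *v y) = (real i * (real d - real i)) *\<^sub>R (matrix_pow X (i - 1) *v y)"
begin

definition submodule where "submodule = span ((\<lambda>i. matrix_pow X i *v y) ` {..<d})"

lemma pow_nonzero: "i < d \<Longrightarrow> matrix_pow X i *v y \<noteq> 0"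
proof (induction i)
  case (Suc i)
  show ?case
  proof
    assume "matrix_pow X (Suc i) *v y = 0"
    then have "(real (Suc i) * (real d - real (Suc i))) *\<^sub>R (matrix_pow X i *v y) = 0"
      using Y_lower[OF Suc.prems] by simp
    then show False using Suc by auto
  qed
qed (simp add: nonzero)

lemma lower_to_generator:
  assumes "subspace U" "\<And>x. x \<in> U \<Longrightarrow> Y *v x \<in> U" "matrix_pow X i *v y \<in> U" "i < d"
  shows "y \<in> U"
  using assms(3,4)
proof (induction i)
  case (Suc i)
  let ?c = "real (Suc i) * (real d - real (Suc i))"
  have "?c *\<^sub>R (matrix_pow X i *v y) \<in> U"
    using assms(2)[OF Suc.prems(1)] Y_lower[OF Suc.prems(2)] by simp
  then have "(1 / ?c) *\<^sub>R (?c *\<^sub>R (matrix_pow X i *v y)) \<in> U"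
    using subspace_scale[OF assms(1)] by blast
  moreover have "?c \<noteq> 0" using Suc.prems by simp
  ultimately have "matrix_pow X i *v y \<in> U" by (simp only: scaleR_scaleR) simp
  then show ?case using Suc by simp
qed simp

lemma components:
  assumes "subspace U" "\<And>x. x \<in> U \<Longrightarrow> H *v x \<in> U"
    and "(\<Sum>i<d. a i *\<^sub>R (matrix_pow X i *v y)) \<in> U" "i < d"
  shows "a i *\<^sub>R (matrix_pow X i *v y) \<in> U"
proof (rule eigenvector_components_in_subspace[where E = "{..<d}" and H = H
      and f = "\<lambda>i. a i *\<^sub>R (matrix_pow X i *v y)" and lam = "\<lambda>i. 2 * real i + 1 - real d"])
  show "inj_on (\<lambda>i. 2 * real i + 1 - real d) {..<d}" by (auto simp: inj_on_def)
qed (use assms in \<open>auto simp: linear_scale[OF linear_matrix_vector] H_weight\<close>)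

lemma chain_inj: "inj_on (\<lambda>i. matrix_pow X i *v y) {..<d}"
proof (rule inj_onI, rule ccontr)
  fix i j assume ij: "i \<in> {..<d}" "j \<in> {..<d}" "matrix_pow X i *v y = matrix_pow X j *v y" "i \<noteq> j"
  have "(2 * real i + 1 - real d) *\<^sub>R (matrix_pow X i *v y) = (2 * real j + 1 - real d) *\<^sub>R (matrix_pow X i *v y)"
    using H_weight[of i] H_weight[of j] ij by simp
  then show False using pow_nonzero[of i] ij by simp
qed

lemma chain_independent: "independent ((\<lambda>i. matrix_pow X i *v y) ` {..<d})"
proof (rule independent_if_scalars_zero)
  fix g x assume g: "(\<Sum>x\<in>(\<lambda>i. matrix_pow X i *v y) ` {..<d}. g x *\<^sub>R x) = 0"
    and "x \<in> (\<lambda>i. matrix_pow X i *v y) ` {..<d}"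
  then obtain i where i: "i < d" "x = matrix_pow X i *v y" by auto
  have "(\<Sum>i<d. g (matrix_pow X i *v y) *\<^sub>R (matrix_pow X i *v y)) \<in> {0}"
    using g by (simp add: sum.reindex[OF chain_inj])
  from components[OF subspace_single_0 _ this i(1)]
  show "g x = 0" using pow_nonzero[OF i(1)] i by simp
qed simp

lemma dim_submodule: "dim submodule = d"
  unfolding submodule_def dim_span_eq_card_independent[OF chain_independent]
  by (simp add: card_image[OF chain_inj])

lemma generator_in_submodule: "y \<in> submodule"
  unfolding submodule_def by (rule span_base, rule image_eqI[of _ _ 0]) (use d_pos in auto)

lemma submodule_subset:
  assumes "subspace U" "\<And>x. x \<in> U \<Longrightarrow> X *v x \<in> U" "y \<in> U"
  shows "submodule \<subseteq> U"
proof -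
  have "matrix_pow X i *v y \<in> U" for i
    by (induction i) (use assms in \<open>auto simp: matrix_pow_Suc_vec\<close>)
  then show ?thesis unfolding submodule_def by (intro span_minimal assms(1)) auto
qed

lemma real_submodule_submodule: "real_submodule {X, H, Y} submodule"
proof -
  let ?S = "(\<lambda>i. matrix_pow X i *v y) ` {..<d}"
  have *: "A *v x \<in> submodule" if "\<And>i. i < d \<Longrightarrow> A *v (matrix_pow X i *v y) \<in> submodule" "x \<in> submodule" for A x
  proof -
    have "(*v) A ` submodule = span ((*v) A ` ?S)"
      unfolding submodule_def by (rule linear_span_image[OF linear_matrix_vector, symmetric])
    also have "\<dots> \<subseteq> submodule"
      using that(1) by (intro span_minimal) (auto simp: submodule_def)
    finally show ?thesis using that(2) by blast
  qed
  have base: "matrix_pow X i *v y \<in> submodule" if "i < d" for i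
    unfolding submodule_def using that by (intro span_base) auto
  have "subspace submodule" by (simp add: submodule_def)
  moreover have "X *v (matrix_pow X i *v y) \<in> submodule" if "i < d" for i
  proof (cases "Suc i < d")
    case True
    then show ?thesis using base[of "Suc i"] by (simp add: matrix_pow_Suc_vec)
  next
    case False
    then have "Suc i = d" using that by simp
    then have "X *v (matrix_pow X i *v y) = 0" using pow_d by (metis matrix_pow_Suc_vec)
    then show ?thesis by (simp add: submodule_def span_zero)
  qed
  moreover have "H *v (matrix_pow X i *v y) \<in> submodule" if "i < d" for i
    using H_weight[OF that] base[OF that] \<open>subspace submodule\<close> subspace_scale by metis
  moreover have "Y *v (matrix_pow X i *v y) \<in> submodule" if "i < d" for i
    using Y_lower[OF that] base[of "i - 1"] that \<open>subspace submodule\<close> by (simp add: subspace_scale)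
  ultimately show ?thesis unfolding real_submodule_triple_iff using * by blast
qed

text \<open>A nonzero submodule contains a nonzero weight component of any of its nonzero vectors;
  lowering reaches \<open>y\<close>, and raising \<open>y\<close> recovers everything.\<close>

lemma irreducible: "irreducible_submodule {X, H, Y} submodule"
  unfolding irreducible_submodule_def
proof (intro conjI allI impI)
  show "real_submodule {X, H, Y} submodule" by (rule real_submodule_submodule)
  show "submodule \<noteq> {0}" using generator_in_submodule nonzero by blast
  fix U assume U: "real_submodule {X, H, Y} U \<and> U \<subseteq> submodule"
  then have sub: "subspace U" and inv: "\<And>x. x \<in> U \<Longrightarrow> X *v x \<in> U \<and> H *v x \<in> U \<and> Y *v x \<in> U"
    by (auto simp: real_submodule_triple_iff)
  show "U = {0} \<or> U = submodule"
  proof (cases "U = {0}")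
    case False
    then obtain x where x: "x \<in> U" "x \<noteq> 0" using subspace_0[OF sub] by blast
    let ?S = "(\<lambda>i. matrix_pow X i *v y) ` {..<d}"
    have "x \<in> span ?S" using x(1) U submodule_def by blast
    then obtain a where "x = (\<Sum>v\<in>?S. a v *\<^sub>R v)" by (auto simp: span_finite)
    then have xa: "x = (\<Sum>i<d. a (matrix_pow X i *v y) *\<^sub>R (matrix_pow X i *v y))"
      by (simp add: sum.reindex[OF chain_inj])
    have "\<exists>i<d. a (matrix_pow X i *v y) \<noteq> 0"
      using x(2) unfolding xa by (metis (no_types, lifting) lessThan_iff scaleR_zero_left sum.neutral)
    then obtain i where i: "i < d" "a (matrix_pow X i *v y) \<noteq> 0" by blast
    have "a (matrix_pow X i *v y) *\<^sub>R (matrix_pow X i *v y) \<in> U"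
      using components[OF sub _ _ i(1), of "\<lambda>i. a (matrix_pow X i *v y)"] inv x(1) xa by simp
    then have "matrix_pow X i *v y \<in> U"
      using subspace_scale[OF sub, of _ "1 / a (matrix_pow X i *v y)"] i(2) by fastforce
    then have "y \<in> U" using lower_to_generator[OF sub] inv i(1) by blast
    then have "submodule \<subseteq> U" using submodule_subset[OF sub] inv by blast
    then show ?thesis using U by blast
  qed simp
qed

end

section \<open>The triple attached to an orthogonal chain basis\<close>

lemma commutator_vec: "commutator A B *v x = A *v (B *v x) - B *v (A *v x)"
  by (simp add: commutator_def matrix_vector_mult_diff_rdistrib matrix_vector_mul_assoc)

lemma trace_commutator: "trace (commutator A B) = 0"
  using trace_mul_sym[of A B] by (simp add: commutator_def trace_sub)

text \<open>Each chain becomes the irreducible module of its length, with \<open>w j\<close> as its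
  lowest rather than highest weight vector, because L(d - 1) is taken in the kernel of Y.\<close>

locale chain_basis_triple = orthogonal_chain_basis X ds w
  for X :: "complex^('p::finite + 'q::finite)^('p + 'q)" and ds w +
  fixes H Y :: "complex^('p + 'q)^('p + 'q)"
  assumes H_u: "j < length ds \<Longrightarrow> i < ds ! j \<Longrightarrow> H *v u j i = (2 * real i + 1 - real (ds ! j)) *\<^sub>R u j i"
    and Y_u: "j < length ds \<Longrightarrow> i < ds ! j \<Longrightarrow> Y *v u j i = (real i * (real (ds ! j) - real i)) *\<^sub>R u j (i - 1)"
begin

lemma matrix_eqI_basis:
  assumes "\<And>j i. j < length ds \<Longrightarrow> i < ds ! j \<Longrightarrow> A *v u j i = B *v u j i"
  shows "A = B"
  by (rule matrix_eq_on_spanning[OF spanning]) (auto simp: chain_vectors_def assms)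

lemma skew_on_basis:
  assumes "\<And>j i k l. j < length ds \<Longrightarrow> i < ds ! j \<Longrightarrow> k < length ds \<Longrightarrow> l < ds ! k \<Longrightarrow>
    form_pq (A *v u j i) (u k l) = - form_pq (u j i) (A *v u k l)"
  shows "form_pq (A *v x) y = - form_pq x (A *v y)"
proof -
  have "form_pq (A *v x) (mat 1 *v y) = -1 * form_pq (mat 1 *v x) (A *v y)"
    by (rule form_pq_eq_on_spanning[OF spanning]) (auto simp: chain_vectors_def assms)
  then show ?thesis by simp
qed

text \<open>For H: paired vectors have i + l + 1 = d and hence opposite weights. For Y: after
  lowering, a pairing requires i + l = d, where both factors equal i l, and the Gram signs (-1)^i
  differ by one step. The traces of H and Y vanish because both are multiples of
  commutators.\<close>

lemma triple:
  assumes "trace X = 0"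
  shows "su_sl2_triple X H Y"
proof -
  have skewH: "form_pq (H *v x) y = - form_pq x (H *v y)" for x y
  proof (rule skew_on_basis)
    fix j i k l assume a: "j < length ds" "i < ds ! j" "k < length ds" "l < ds ! k"
    show "form_pq (H *v u j i) (u k l) = - form_pq (u j i) (H *v u k l)"
    proof (cases "j = k \<and> Suc (i + l) = ds ! j")
      case True
      then have "2 * real i + 1 - real (ds ! j) = - (2 * real l + 1 - real (ds ! j))" by linarith
      then have "H *v u j i = (- (2 * real l + 1 - real (ds ! j))) *\<^sub>R u j i"
        using H_u[of j i] a by simp
      moreover have "H *v u k l = (2 * real l + 1 - real (ds ! j)) *\<^sub>R u j l"
        using H_u[of k l] a True by simp
      ultimately show ?thesis using True
        by (simp add: form_pq_scaleR_left form_pq_scaleR_right left_diff_distrib)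
    qed (use a in \<open>auto simp: H_u form_pq_scaleR_left form_pq_scaleR_right gram\<close>)
  qed
  have skewY: "form_pq (Y *v x) y = - form_pq x (Y *v y)" for x y
  proof (rule skew_on_basis)
    fix j i k l assume a: "j < length ds" "i < ds ! j" "k < length ds" "l < ds ! k"
    show "form_pq (Y *v u j i) (u k l) = - form_pq (u j i) (Y *v u k l)"
    proof (cases "j = k \<and> i + l = ds ! j")
      case True
      then have "l < ds ! j" "i + l = ds ! j" using a by simp_all
      then have "0 < i \<and> 0 < l" using a(2) by linarith
      then obtain i' l' where s: "i = Suc i'" "l = Suc l'" using gr0_implies_Suc by metis
      have N: "real (ds ! j) - real i = real l" "real (ds ! j) - real l = real i"
        using True by linarith+
      have "Suc (i' + l) = ds ! j" "Suc (i + l') = ds ! j" using True s by auto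
      then have "form_pq (u j i') (u j l) = - form_pq (u j i) (u j l')"
        using a s by (simp only: gram) simp
      moreover have "Y *v u j i = (real i * real l) *\<^sub>R u j i'" "Y *v u k l = (real i * real l) *\<^sub>R u j l'"
        using a True s Y_u[of j i] Y_u[of k l] N by (simp_all add: mult.commute)
      ultimately show ?thesis using True by (simp add: form_pq_scaleR_left form_pq_scaleR_right)
    next
      case False
      then have "i = 0 \<or> form_pq (u j (i - 1)) (u k l) = 0" "l = 0 \<or> form_pq (u j i) (u k (l - 1)) = 0"
        using a by (auto simp: gram)
      then show ?thesis using a by (auto simp: Y_u form_pq_scaleR_left form_pq_scaleR_right)
    qed
  qed
  have HX: "commutator H X = 2 *\<^sub>R X"
  proof (rule matrix_eqI_basis)
    fix j i assume a: "j < length ds" "i < ds ! j"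
    have X_u: "X *v u j i = u j (Suc i)" by (simp add: matrix_pow_Suc_vec)
    have "H *v u j (Suc i) = (2 * real (Suc i) + 1 - real (ds ! j)) *\<^sub>R u j (Suc i)"
      by (cases "Suc i < ds ! j") (use a in \<open>auto simp: H_u u_eq_0\<close>)
    then show "commutator H X *v u j i = (2 *\<^sub>R X) *v u j i"
      using a by (simp add: commutator_vec scaleR_matrix_vector_mult H_u X_u
          linear_scale[OF linear_matrix_vector] algebra_simps flip: scaleR_diff_left)
  qed
  have HY: "commutator H Y = - (2 *\<^sub>R Y)"
  proof (rule matrix_eqI_basis)
    fix j i assume a: "j < length ds" "i < ds ! j"
    show "commutator H Y *v u j i = (- (2 *\<^sub>R Y)) *v u j i"
    proof (cases i)
      case (Suc i')
      then show ?thesis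
        using a by (simp add: commutator_vec minus_matrix_vector_mult scaleR_matrix_vector_mult H_u Y_u
            linear_scale[OF linear_matrix_vector] algebra_simps flip: scaleR_diff_left scaleR_minus_left)
    qed (use a H_u[of j i] Y_u[of j i] in \<open>simp add: commutator_vec minus_matrix_vector_mult scaleR_matrix_vector_mult
            linear_scale[OF linear_matrix_vector]\<close>)
  qed
  have XY: "commutator X Y = H"
  proof (rule matrix_eqI_basis)
    fix j i assume a: "j < length ds" "i < ds ! j"
    let ?N = "real (ds ! j)"
    have X_u: "X *v u j i = u j (Suc i)" for i by (simp add: matrix_pow_Suc_vec)
    have "X *v (Y *v u j i) = (real i * (?N - real i)) *\<^sub>R u j i"
      by (cases i) (use a Y_u[of j i] in \<open>simp_all add: X_u linear_scale[OF linear_matrix_vector]\<close>)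
    moreover have "Y *v (X *v u j i) = ((real i + 1) * (?N - real i - 1)) *\<^sub>R u j i"
    proof (cases "Suc i < ds ! j")
      case False
      then have "?N = real i + 1" using a by linarith
      then show ?thesis using False a by (simp add: X_u u_eq_0)
    qed (use a in \<open>simp add: X_u Y_u algebra_simps\<close>)
    ultimately show "commutator X Y *v u j i = H *v u j i"
      using a by (simp add: commutator_vec H_u algebra_simps flip: scaleR_diff_left)
  qed
  have "trace H = 0" using XY trace_commutator by metis
  moreover have "trace (- (2 *\<^sub>R Y)) = 0" using HY trace_commutator by metis
  then have "trace Y = 0" by (simp add: trace_def sum_negf flip: scaleR_sum_right)
  ultimately show ?thesis
    using assms skew skewH skewY HX HY XY by (simp add: su_sl2_triple_def su_pq_iff skew_pq_def)
qed

text \<open>Chains of equal length carry the same weights and lowering factors, so complex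
  combinations of their generators inherit them.\<close>

lemma lowest_weight_vectorI:
  assumes "d > 0" "y \<in> vec.span (w ` parts_of_size d)" "y \<noteq> 0"
  shows "lowest_weight_vector X H Y y d"
proof
  have w: "j < length ds" "ds ! j = d" if "j \<in> parts_of_size d" for j
    using that by (auto simp: parts_of_size_def)
  show "matrix_pow X d *v y = 0"
    using matrix_vector_eq_on_span[OF assms(2), of "matrix_pow X d" 0] w u_eq_0 by force
  fix i assume i: "i < d"
  show "H *v (matrix_pow X i *v y) = (2 * real i + 1 - real d) *\<^sub>R (matrix_pow X i *v y)"
    using matrix_vector_eq_on_span[OF assms(2), of "H ** matrix_pow X i" "(2 * real i + 1 - real d) *\<^sub>R matrix_pow X i"]
    using w H_u i by (fastforce simp: scaleR_matrix_vector_mult simp flip: matrix_vector_mul_assoc)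
  show "Y *v (matrix_pow X i *v y) = (real i * (real d - real i)) *\<^sub>R (matrix_pow X (i - 1) *v y)"
    using matrix_vector_eq_on_span[OF assms(2), of "Y ** matrix_pow X i" "(real i * (real d - real i)) *\<^sub>R matrix_pow X (i - 1)"]
    using w Y_u i by (fastforce simp: scaleR_matrix_vector_mult simp flip: matrix_vector_mul_assoc)
qed (use assms in auto)

text \<open>By skewness the kernel of Y is orthogonal to its image, and the image contains every
  vector of a chain except the last. In the dual expansion only the coefficients of the generators
  survive.\<close>

lemma kernel_Y_orthogonal:
  assumes "Y *v x = 0" "trace X = 0" "j < length ds" "Suc l < ds ! j"
  shows "form_pq (u j l) x = 0"
proof -
  have "form_pq (Y *v u j (Suc l)) x = - form_pq (u j (Suc l)) (Y *v x)"
    using triple[OF assms(2)] by (simp add: su_sl2_triple_def su_pq_iff)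
  moreover have "Y *v u j (Suc l) = (real (Suc l) * (real (ds ! j) - real (Suc l))) *\<^sub>R u j l" (is "_ = ?c *\<^sub>R _")
    using Y_u[of j "Suc l"] assms by simp
  ultimately have "of_real ?c * form_pq (u j l) x = 0"
    using assms(1) by (simp only: form_pq_scaleR_left) simp
  moreover have "?c \<noteq> 0" using assms by simp
  ultimately show ?thesis using of_real_eq_0_iff mult_eq_0_iff by metis
qed

lemma kernel_Y:
  assumes "Y *v x = 0" "trace X = 0"
  shows "\<exists>c. x = (\<Sum>j<length ds. c j *s w j)"
proof -
  let ?K = "(\<lambda>j. (j, 0)) ` {..<length ds}"
  have "x \<in> vec.span ((\<lambda>(j, i). u j i) ` ?K)"
  proof (rule in_span_basis)
    show "?K \<subseteq> J" using part_pos by auto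
    fix j i assume "(j, i) \<in> J - ?K"
    then have "j < length ds" "i < ds ! j" "i > 0" by auto
    then show "form_pq (u j (ds ! j - Suc i)) x = 0"
      by (intro kernel_Y_orthogonal assms) auto
  qed
  then have "x \<in> vec.span (w ` {..<length ds})" by (simp add: image_image)
  then show ?thesis
  proof (induction rule: vec.span_induct_alt)
    case base
    then show ?case by (intro exI[of _ "\<lambda>_. 0"]) simp
  next
    case (step a v z)
    then obtain k c where "k < length ds" "v = w k" "z = (\<Sum>j<length ds. c j *s w j)" by blast
    then show ?case
      by (intro exI[of _ "\<lambda>j. c j + (if j = k then a else 0)"])
        (simp add: vec.scale_left_distrib sum.distrib if_distrib[of "\<lambda>a. a *s _"] cong: if_cong)
  qed
qed

lemma Y_nilpotent: "j < length ds \<Longrightarrow> i < ds ! j \<Longrightarrow> matrix_pow Y (Suc i) *v u j i = 0"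
proof (induction i)
  case 0
  then show ?case using Y_u[of j 0] by (simp add: matrix_pow_Suc)
next
  case (Suc i)
  have "matrix_pow Y (Suc (Suc i)) *v u j (Suc i) = matrix_pow Y (Suc i) *v (Y *v u j (Suc i))"
    by (rule matrix_pow_Suc_vec')
  also have "\<dots> = 0"
    using Suc by (simp only: Y_u linear_scale[OF linear_matrix_vector]) simp
  finally show ?case .
qed

lemma Y_pow_zero: "matrix_pow Y (sum_list ds) = 0"
proof (rule matrix_eqI_basis)
  fix j i assume a: "j < length ds" "i < ds ! j"
  then have "ds ! j \<le> sum_list ds" by (simp add: member_le_sum_list)
  then show "matrix_pow Y (sum_list ds) *v u j i = 0 *v u j i"
    using matrix_pow_eq_0_mono[OF Y_nilpotent[OF a], of "sum_list ds"] a by simp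
qed

text \<open>Lower a vector of \<open>W\<close> until the next step gives 0. The result is a sum over
  chain lengths e of components \<open>f e\<close> with distinct H-weights 1 - e, all of which stay
  in \<open>W\<close>. A nonzero one generates an irreducible submodule of real dimension e inside
  \<open>W\<close>, hence all of \<open>W\<close>.\<close>

lemma irreducible_submodule_generated:
  assumes W: "irreducible_submodule {X, H, Y} W" and "trace X = 0"
  shows "\<exists>y\<in>vec.span (w ` parts_of_size (dim W)). W \<subseteq> span (range (\<lambda>i. matrix_pow X i *v y))"
proof -
  have sub: "subspace W" and inv: "\<And>x. x \<in> W \<Longrightarrow> X *v x \<in> W \<and> H *v x \<in> W \<and> Y *v x \<in> W"
    and W0: "W \<noteq> {0}"
    using W by (auto simp: irreducible_submodule_def real_submodule_triple_iff)
  obtain x where x: "x \<in> W" "x \<noteq> 0" using W0 subspace_0[OF sub] by blast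
  define n where "n = (LEAST n. matrix_pow Y n *v x = 0)"
  have n: "matrix_pow Y n *v x = 0"
    unfolding n_def by (rule LeastI[of _ "sum_list ds"]) (simp add: Y_pow_zero)
  then obtain m where m: "n = Suc m" using x by (cases n) auto
  define y where "y = matrix_pow Y m *v x"
  have y0: "y \<noteq> 0" unfolding y_def
    using not_less_Least[of m "\<lambda>n. matrix_pow Y n *v x = 0"] m n_def by simp
  have Yy: "Y *v y = 0" using n by (simp add: y_def m matrix_pow_Suc_vec)
  have "matrix_pow Y k *v x \<in> W" for k
    by (induction k) (use x inv in \<open>auto simp: matrix_pow_Suc_vec\<close>)
  then have yW: "y \<in> W" by (simp add: y_def)
  obtain c where c: "y = (\<Sum>j<length ds. c j *s w j)" using kernel_Y[OF Yy assms(2)] by blast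
  define f where "f = (\<lambda>e. \<Sum>j\<in>parts_of_size e. c j *s w j)"
  have f_span: "f e \<in> vec.span (w ` parts_of_size e)" for e
    unfolding f_def by (intro vec.span_sum vec.span_scale vec.span_base) auto
  have y_sum: "y = sum f (set ds)"
  proof -
    have "sum f (set ds) = (\<Sum>e\<in>set ds. \<Sum>j\<in>{j\<in>{..<length ds}. ds ! j = e}. c j *s w j)"
      by (simp add: f_def parts_of_size_def)
    also have "\<dots> = y" unfolding c by (rule sum.group) auto
    finally show ?thesis by simp
  qed
  have e_pos: "e > 0" if "e \<in> set ds" for e
    using that part_pos by (auto simp: in_set_conv_nth)
  have fW: "f e \<in> W" if "e \<in> set ds" for e
  proof (rule eigenvector_components_in_subspace[where E = "set ds" and H = H and lam = "\<lambda>e. 1 - real e"])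
    fix e assume e: "e \<in> set ds"
    show "H *v f e = (1 - real e) *\<^sub>R f e"
    proof (cases "f e = 0")
      case False
      interpret lowest_weight_vector X H Y "f e" e
        by (rule lowest_weight_vectorI[OF e_pos[OF e] f_span False])
      show ?thesis using H_weight[of 0] d_pos by simp
    qed simp
  qed (use sub inv yW y_sum that in \<open>auto simp: inj_on_def\<close>)
  obtain e where e: "e \<in> set ds" "f e \<noteq> 0"
    using y0 y_sum by (metis sum.neutral)
  interpret lowest_weight_vector X H Y "f e" e
    by (rule lowest_weight_vectorI[OF e_pos[OF e(1)] f_span e(2)])
  have "submodule \<subseteq> W" using submodule_subset[OF sub] inv fW[OF e(1)] by blast
  moreover have "submodule \<noteq> {0}" using irreducible by (simp add: irreducible_submodule_def)
  ultimately have eq: "W = submodule"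
    using W real_submodule_submodule unfolding irreducible_submodule_def by blast
  then have "dim W = e" by (simp add: dim_submodule)
  moreover have "W \<subseteq> span (range (\<lambda>i. matrix_pow X i *v f e))"
    unfolding eq submodule_def by (rule span_mono) auto
  ultimately show ?thesis using f_span by blast
qed

text \<open>M(d - 1) is bounded from above by \<open>?M\<close>, the orthogonal complement of all
  chains of other lengths; intersecting with the kernel of Y leaves only generators of chains of
  length d. Conversely, every nonzero combination of these is the lowest weight vector of an
  irreducible submodule of real dimension d.\<close>

lemma L_space_eq:
  assumes "d > 0" "trace X = 0"
  shows "L_space X H Y (d - 1) = vec.span (w ` parts_of_size d)"
proof
  let ?M = "{x. \<forall>k l. k < length ds \<and> ds ! k \<noteq> d \<longrightarrow> form_pq (u k l) x = 0}"
  have sub: "vec.subspace ?M"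
    by (auto simp: vec.subspace_def form_pq_add_right form_pq_scale_right)
  have "matrix_pow X i *v y \<in> ?M" if "y \<in> vec.span (w ` parts_of_size d)" for y i
  proof -
    have inM: "matrix_pow X i *v v \<in> ?M" if "v \<in> w ` parts_of_size d" for v
      using that by (auto simp: parts_of_size_def gram)
    have "(*v) (matrix_pow X i) ` vec.span (w ` parts_of_size d) \<subseteq> ?M"
      unfolding vec.span_image[symmetric] using inM by (intro vec.span_minimal sub) blast
    then show ?thesis using that by blast
  qed
  then have gen: "span (range (\<lambda>i. matrix_pow X i *v y)) \<subseteq> ?M" if "y \<in> vec.span (w ` parts_of_size d)" for y
    using that by (intro span_minimal vec_subspace_imp_subspace[OF sub] image_subsetI)
  then have "W \<subseteq> ?M" if W: "irreducible_submodule {X, H, Y} W" "dim W = d" for W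
  proof -
    obtain y where "y \<in> vec.span (w ` parts_of_size d)" "W \<subseteq> span (range (\<lambda>i. matrix_pow X i *v y))"
      using irreducible_submodule_generated[OF W(1) assms(2)] W(2) by blast
    then show ?thesis using gen by (meson order_trans)
  qed
  then have M: "M_space X H Y (d - 1) \<subseteq> ?M"
    unfolding M_space_def using assms(1)
    by (intro span_minimal vec_subspace_imp_subspace[OF sub]) auto
  show "L_space X H Y (d - 1) \<subseteq> vec.span (w ` parts_of_size d)"
  proof
    fix x assume "x \<in> L_space X H Y (d - 1)"
    then have x: "Y *v x = 0" "x \<in> ?M" using M by (auto simp: L_space_def)
    let ?K = "(\<lambda>j. (j, 0)) ` parts_of_size d"
    have "x \<in> vec.span ((\<lambda>(j, i). u j i) ` ?K)"
    proof (rule in_span_basis)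
      show "?K \<subseteq> J" using assms(1) by (auto simp: parts_of_size_def)
      fix j i assume ji: "(j, i) \<in> J - ?K"
      show "form_pq (u j (ds ! j - Suc i)) x = 0"
      proof (cases "ds ! j = d")
        case True
        then have "i > 0" using ji by (auto simp: parts_of_size_def)
        then show ?thesis using ji by (intro kernel_Y_orthogonal x assms) auto
      qed (use x ji in auto)
    qed
    then show "x \<in> vec.span (w ` parts_of_size d)" by (simp add: image_image)
  qed
  show "vec.span (w ` parts_of_size d) \<subseteq> L_space X H Y (d - 1)"
  proof
    fix y assume y: "y \<in> vec.span (w ` parts_of_size d)"
    show "y \<in> L_space X H Y (d - 1)"
    proof (cases "y = 0")
      case True
      then show ?thesis by (simp add: L_space_def M_space_def span_zero)
    next
      case False
      interpret lowest_weight_vector X H Y y d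
        by (rule lowest_weight_vectorI[OF assms(1) y False])
      have "y \<in> M_space X H Y (d - 1)"
        unfolding M_space_def using irreducible dim_submodule generator_in_submodule assms(1)
        by (intro span_base) auto
      moreover have "Y *v y = 0" using Y_lower[of 0] assms(1) by simp
      ultimately show ?thesis by (simp add: L_space_def)
    qed
  qed
qed

text \<open>The relabelling \<open>h\<close> of the generators is recorded along with the basis, so
  that \<open>p_mult_eq\<close> can transport the count of signs to
  \<open>positive_parts\<close>.\<close>

lemma adapted_basis_exists:
  assumes "d > 0" "trace X = 0"
  shows "\<exists>v. adapted_basis X H Y d v \<and>
    (\<exists>h. bij_betw h {1..count (jordan_partition X) d} (parts_of_size d) \<and> v = w \<circ> h)"
proof -
  let ?t = "count (jordan_partition X) d"
  obtain h where h: "bij_betw h {1..?t} (parts_of_size d)"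
    using finite_same_card_bij[of "{1..?t}" "parts_of_size d"] card_parts_of_size by auto
  have img: "(w \<circ> h) ` {1..?t} = w ` parts_of_size d"
    using h by (simp only: image_comp[symmetric] bij_betw_def)
  have h': "h j \<in> parts_of_size d" if "j \<in> {1..?t}" for j
    using h that by (auto simp: bij_betw_def)
  have hinj: "h j = h k \<longleftrightarrow> j = k" if "j \<in> {1..?t}" "k \<in> {1..?t}" for j k
    using h that by (auto simp: bij_betw_def inj_on_def)
  let ?K = "(\<lambda>j. (j, 0)) ` parts_of_size d"
  have KJ: "?K \<subseteq> J" using assms(1) by (auto simp: parts_of_size_def)
  have wK: "w ` parts_of_size d = (\<lambda>(j, i). u j i) ` ?K" by (simp add: image_image)
  have "vec.independent (w ` parts_of_size d)"
    unfolding wK by (rule vec.independent_mono[OF basis_independent(2) image_mono[OF KJ]])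
  moreover have "inj_on (w \<circ> h) {1..?t}"
  proof (rule comp_inj_on)
    show "inj_on h {1..?t}" using h by (simp add: bij_betw_def)
    have "inj_on w (parts_of_size d)"
    proof (rule inj_onI)
      fix j k assume jk: "j \<in> parts_of_size d" "k \<in> parts_of_size d" "w j = w k"
      then have "(j, 0) = (k, 0 :: nat)"
        using KJ by (intro inj_onD[OF basis_independent(1)]) auto
      then show "j = k" by simp
    qed
    then show "inj_on w (h ` {1..?t})" using h by (simp add: bij_betw_def)
  qed
  moreover have "form_pq (w (h j)) (u (h k) (d - 1)) = 0"
    if "j \<in> {1..?t}" "k \<in> {1..?t}" "j \<noteq> k" for j k
    using gram[of "h j" "h k" 0 "d - 1"] h'[OF that(1)] h'[OF that(2)] hinj[OF that(1,2)] that(3)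
    by (simp add: parts_of_size_def)
  moreover have "form_pq (w (h j)) (u (h j) (d - 1)) \<in> (if odd d then {1, - 1} else {\<i>, - \<i>})"
    if "j \<in> {1..?t}" for j
    using gram_sign[of "h j"] h'[OF that] unfolding unit_signs_def parts_of_size_def by auto
  ultimately have "adapted_basis X H Y d (w \<circ> h)"
    unfolding adapted_basis_def Let_def img L_space_eq[OF assms] by simp
  then show ?thesis using h by blast
qed

end

lemma (in orthogonal_chain_basis) triple_exists: "\<exists>H Y. chain_basis_triple X ds w H Y"
proof -
  obtain H :: "complex^('p + 'q)^('p + 'q)" where
    H: "\<And>k. k \<in> J \<Longrightarrow> H *v (case k of (j, i) \<Rightarrow> u j i) = (case k of (j, i) \<Rightarrow> (2 * real i + 1 - real (ds ! j)) *\<^sub>R u j i)"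
    using obtain_matrix_on_basis[OF basis_independent] by blast
  obtain Y :: "complex^('p + 'q)^('p + 'q)" where
    Y: "\<And>k. k \<in> J \<Longrightarrow> Y *v (case k of (j, i) \<Rightarrow> u j i) = (case k of (j, i) \<Rightarrow> (real i * (real (ds ! j) - real i)) *\<^sub>R u j (i - 1))"
    using obtain_matrix_on_basis[OF basis_independent] by blast
  show ?thesis
    by (intro exI, unfold_locales) (use H[of "(_, _)"] Y[of "(_, _)"] in auto)
qed

section \<open>Reality\<close>

lemma Ad_eq_minus_iff:
  fixes g X :: "complex^'n^'n"
  assumes "det g \<noteq> 0"
  shows "- X = Ad g X \<longleftrightarrow> g ** X = - (X ** g)"
proof -
  have "\<exists>g'. g ** g' = mat 1 \<and> g' ** g = mat 1"
    using assms unfolding invertible_det_nz[symmetric] invertible_def .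
  then have inv: "g ** matrix_inv g = mat 1" "matrix_inv g ** g = mat 1"
    unfolding matrix_inv_def by (metis (mono_tags, lifting) someI_ex)+
  have neg: "(- X) ** A = - (X ** A)" for A
    by (simp add: matrix_eq minus_matrix_vector_mult flip: matrix_vector_mul_assoc)
  show ?thesis
  proof
    assume "- X = Ad g X"
    then have "(- X) ** g = g ** X ** (matrix_inv g ** g)"
      by (simp add: Ad_def matrix_mul_assoc)
    then show "g ** X = - (X ** g)" by (simp add: inv neg)
  next
    assume "g ** X = - (X ** g)"
    then have "Ad g X = ((- X) ** g) ** matrix_inv g" by (simp add: Ad_def neg)
    also have "\<dots> = (- X) ** (g ** matrix_inv g)" by (simp only: matrix_mul_assoc)
    finally show "- X = Ad g X" by (simp add: inv)
  qed
qed

lemma anticommuting_matrix_pow: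
  fixes g X :: "complex^'n^'n"
  assumes "g ** X = - (X ** g)"
  shows "matrix_pow X k *v (g *v x) = (-1) ^ k *s (g *v (matrix_pow X k *v x))"
proof (induction k)
  case (Suc k)
  have "X *v (g *v y) = - (g *v (X *v y))" for y
    using assms by (metis minus_matrix_vector_mult minus_minus matrix_vector_mul_assoc)
  then show ?case using Suc by (simp add: matrix_pow_Suc_vec vec.scale)
qed simp

text \<open>The permutation is taken of the form \<open>\<rho> \<circ> \<rho>\<close> because its sign is then 1.\<close>

lemma det_monomial:
  fixes u :: "'k \<Rightarrow> complex^'n" and T :: "complex^'n^'n"
  assumes "inj_on u K" "vec.independent (u ` K)" "vec.span (u ` K) = UNIV"
    and T: "\<And>k. k \<in> K \<Longrightarrow> T *v u k = c k *s u (\<rho> (\<rho> k))" and \<rho>: "bij_betw \<rho> K K"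
  shows "det T = (\<Prod>k\<in>K. c k)"
proof -
  have "finite (u ` K)" by (rule vec.finiteI_independent[OF assms(2)])
  then have fin: "finite K" using assms(1) finite_imageD by blast
  have "card K = card (u ` K)" using card_image[OF assms(1)] by simp
  also have "\<dots> = vec.dim (UNIV :: (complex^'n) set)"
    using vec.dim_span_eq_card_independent[OF assms(2)] assms(3) by simp
  also have "\<dots> = CARD('n)" by (rule vec_dim_card)
  finally obtain b :: "'n \<Rightarrow> 'k" where b: "bij_betw b UNIV K"
    using finite_same_card_bij[of "UNIV :: 'n set" K] fin by auto
  have bK: "b i \<in> K" for i using b by (auto simp: bij_betw_def)
  \<comment> \<open>\<open>U\<close> has the basis vectors as columns and \<open>q\<close> is
    \<open>\<rho>\<close> transported to column indices, so \<open>T ** U\<close> is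
    \<open>U\<close> with columns permuted by \<open>q \<circ> q\<close> and then scaled.\<close>
  define U :: "complex^'n^'n" where "U = (\<chi> r i. u (b i) $ r)"
  define q where "q = the_inv_into UNIV b \<circ> \<rho> \<circ> b"
  have q: "b (q i) = \<rho> (b i)" for i
    by (simp add: q_def f_the_inv_into_f_bij_betw[OF b] bij_betw_apply[OF \<rho> bK])
  have "bij_betw q UNIV UNIV" unfolding q_def
    by (intro bij_betw_trans[OF b] bij_betw_trans[OF \<rho>] bij_betw_the_inv_into[OF b])
  then have qp: "q permutes UNIV" by (rule bij_imp_permutes) simp
  then have perm: "permutation q" using permutation_permutes finite_class.finite_UNIV by blast
  have "sign (q \<circ> q) = 1" by (simp add: sign_compose[OF perm perm])
  moreover have "q \<circ> q permutes UNIV" by (rule permutes_compose[OF qp qp])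
  ultimately have Uq: "det (\<chi> r i. U $ r $ (q \<circ> q) i) = det U"
    using det_permute_columns[of "q \<circ> q" U] by simp
  define D :: "complex^'n^'n" where "D = (\<chi> r i. if r = i then c (b i) else 0)"
  have "T ** U = (\<chi> r i. U $ r $ (q \<circ> q) i) ** D"
  proof -
    have "(T ** U) $ r $ i = ((\<chi> r i. U $ r $ (q \<circ> q) i) ** D) $ r $ i" for r i
    proof -
      have "(T ** U) $ r $ i = (T *v u (b i)) $ r"
        by (simp add: matrix_matrix_mult_def matrix_vector_mult_def U_def)
      also have "\<dots> = c (b i) * U $ r $ q (q i)"
        by (simp add: T bK U_def q)
      also have "\<dots> = ((\<chi> r i. U $ r $ (q \<circ> q) i) ** D) $ r $ i"
        by (simp add: matrix_matrix_mult_def D_def if_distrib[of "\<lambda>a. _ * a"] cong: if_cong)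
      finally show ?thesis .
    qed
    then show ?thesis by (simp add: vec_eq_iff)
  qed
  then have "det T * det U = det U * det D" by (metis Uq det_mul)
  moreover have "det U \<noteq> 0"
  proof -
    obtain B :: "complex^'n^'n" where B: "\<And>k. k \<in> K \<Longrightarrow> B *v u k = axis (the_inv_into UNIV b k) 1"
      using obtain_matrix_on_basis[OF assms(1,2), where f = "\<lambda>k. axis (the_inv_into UNIV b k) 1"] by blast
    have "(B ** U) $ r $ i = mat 1 $ r $ i" for r i
    proof -
      have "(B ** U) $ r $ i = (B *v u (b i)) $ r"
        by (simp add: matrix_matrix_mult_def matrix_vector_mult_def U_def)
      also have "\<dots> = mat 1 $ r $ i"
        using b by (simp add: B bK the_inv_into_f_f bij_betw_def mat_def axis_def)
      finally show ?thesis .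
    qed
    then have "B ** U = mat 1" by (simp add: vec_eq_iff)
    then have "det B * det U = 1" by (metis det_mul det_I)
    then show ?thesis by auto
  qed
  ultimately have "det T = det D" by simp
  also have "\<dots> = (\<Prod>i\<in>UNIV. c (b i))" by (simp add: det_diagonal D_def)
  also have "\<dots> = (\<Prod>k\<in>K. c k)" by (rule prod.reindex_bij_betw[OF b])
  finally show ?thesis .
qed

lemma involution_swapping:
  assumes "finite A" "finite B" "card A = card B" "A \<inter> B = {}"
  shows "\<exists>\<pi>. (\<forall>x\<in>A. \<pi> x \<in> B \<and> \<pi> (\<pi> x) = x) \<and> (\<forall>x\<in>B. \<pi> x \<in> A \<and> \<pi> (\<pi> x) = x)"
proof -
  obtain h where h: "bij_betw h A B" using finite_same_card_bij assms by blast
  define \<pi> where "\<pi> = (\<lambda>x. if x \<in> A then h x else inv_into A h x)"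
  have "inv_into A h x \<in> A" "h (inv_into A h x) = x" if "x \<in> B" for x
    using h that by (auto simp: bij_betw_def inv_into_into f_inv_into_f)
  moreover have "h x \<in> B" "inv_into A h (h x) = x" if "x \<in> A" for x
    using h that by (auto simp: bij_betw_def)
  ultimately show ?thesis using assms(4)
    by (intro exI[of _ \<pi>]) (auto simp: \<pi>_def)
qed

lemma prod_alternating: "(\<Prod>i<n. (-1) ^ i) = (-1 :: complex) ^ (n div 2)"
proof (induction n)
  case (Suc n)
  then show ?case by (cases "even n") (auto elim!: evenE oddE)
qed simp

text \<open>The form <x, X^(d-1) y> is Hermitian for odd d and skew-Hermitian for even d; the factor
  i makes it Hermitian in both cases, with p_d counting the value 1.\<close>

definition sign_normalizer :: "nat \<Rightarrow> complex" where
  "sign_normalizer d = (if odd d then 1 else \<i>)"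

lemma plus_count_eq:
  "plus_count X d v =
     card {j\<in>{1..count (jordan_partition X) d}. sign_normalizer d * form_pq (v j) (matrix_pow X (d - 1) *v v j) = 1}"
  by (simp add: plus_count_def Let_def sign_normalizer_def)

lemma sign_normalizer_unit_signs: "s \<in> unit_signs d \<Longrightarrow> sign_normalizer d * s = 1 \<or> sign_normalizer d * s = -1"
  by (auto simp: sign_normalizer_def unit_signs_def split: if_splits)

section \<open>Invariance of p_d and its balance for real elements\<close>

context orthogonal_chain_basis
begin

lemma pow_sum_list_eq_0: "matrix_pow X (sum_list ds) *v x = 0"
proof -
  have "matrix_pow X (sum_list ds) = 0"
  proof (rule matrix_eq_on_spanning[OF spanning])
    fix x assume "x \<in> chain_vectors X ds w"
    then obtain j i where ji: "j < length ds" "x = u j i" by (auto simp: chain_vectors_def)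
    have "ds ! j \<le> sum_list ds" using ji by (simp add: member_le_sum_list)
    then show "matrix_pow X (sum_list ds) *v x = 0 *v x" using ji by (simp add: pow_u u_eq_0)
  qed
  then show ?thesis by simp
qed

lemma adapted_basis_kernel:
  assumes "d > 0" "adapted_basis X H Y d v" "j \<in> {1..count (jordan_partition X) d}"
  shows "matrix_pow X d *v v j = 0"
proof -
  have "v j \<in> vec.span (v ` {1..count (jordan_partition X) d})"
    using assms(3) by (intro vec.span_base) auto
  then have "v j \<in> M_space X H Y (d - 1)"
    using assms(2) by (auto simp: adapted_basis_def Let_def L_space_def)
  then show ?thesis using M_space_subset_kernel[OF pow_sum_list_eq_0, of H Y "d - 1"] assms(1) by auto
qed

text \<open>The signature bound applied across the two bases: the positive members of
  \<open>v\<close> and the negative members of \<open>v'\<close> number at most t together, and the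
  latter are t minus the positive members of \<open>v'\<close>.\<close>

lemma plus_count_le:
  assumes "d > 0" "adapted_basis X H Y d v" "adapted_basis X H' Y' d v'"
  shows "plus_count X d v \<le> plus_count X d v'"
proof -
  let ?t = "count (jordan_partition X) d"
  let ?B = "\<lambda>v j. sign_normalizer d * form_pq (v j) (matrix_pow X (d - 1) *v v j)"
  let ?A = "{j\<in>{1..?t}. ?B v j = 1}" and ?A' = "{j\<in>{1..?t}. ?B v' j = 1}"
  have sign: "?B v' j = -1" if "j \<in> {1..?t} - ?A'" for j
  proof -
    have "form_pq (v' j) (matrix_pow X (d - 1) *v v' j) \<in> unit_signs d"
      using assms(3) that by (auto simp: adapted_basis_def Let_def unit_signs_def)
    then show ?thesis using sign_normalizer_unit_signs that by blast
  qed
  have "card ?A + card ({1..?t} - ?A') \<le> ?t"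
  proof (rule signature_bound[OF \<open>d > 0\<close>, where s = "sign_normalizer d" and x = v and y = v'])
    fix a a' assume "a \<in> ?A" "a' \<in> ?A"
    then show "sign_normalizer d * form_pq (v a) (matrix_pow X (d - 1) *v v a') = (if a = a' then 1 else 0)"
      using assms(2) by (auto simp: adapted_basis_def Let_def)
  next
    fix a a' assume a: "a \<in> {1..?t} - ?A'" "a' \<in> {1..?t} - ?A'"
    then show "sign_normalizer d * form_pq (v' a) (matrix_pow X (d - 1) *v v' a') = (if a = a' then -1 else 0)"
      using assms(3) sign[OF a(1)] by (auto simp: adapted_basis_def Let_def)
  qed (use adapted_basis_kernel assms in auto)
  moreover have "card ({1..?t} - ?A') = ?t - card ?A'" by (subst card_Diff_subset) auto
  moreover have "card ?A' \<le> card {1..?t}" by (rule card_mono) auto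
  ultimately show ?thesis unfolding plus_count_eq card_atLeastAtMost by linarith
qed

definition positive_parts where
  "positive_parts d = {j \<in> parts_of_size d. sign_normalizer d * form_pq (w j) (u j (d - 1)) = 1}"

lemma positive_parts_subset: "positive_parts d \<subseteq> parts_of_size d"
  by (auto simp: positive_parts_def)

text \<open>The explicit triple realizes the value; \<open>plus_count_le\<close>, used in both
  directions, excludes every other value.\<close>

lemma p_mult_eq:
  assumes "d > 0" "trace X = 0"
  shows "p_mult X d = card (positive_parts d)"
  unfolding p_mult_def
proof (rule the_equality)
  let ?t = "count (jordan_partition X) d"
  obtain H Y where "chain_basis_triple X ds w H Y" using triple_exists by blast
  then interpret chain_basis_triple X ds w H Y .
  obtain h where ad: "adapted_basis X H Y d (w \<circ> h)" and h: "bij_betw h {1..?t} (parts_of_size d)"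
    using adapted_basis_exists[OF assms] by blast
  have "bij_betw h {j\<in>{1..?t}. sign_normalizer d * form_pq (w (h j)) (u (h j) (d - 1)) = 1} (positive_parts d)"
  proof (rule bij_betw_subset[OF h])
    have "parts_of_size d = h ` {1..?t}" using h by (simp add: bij_betw_def)
    then show "h ` {j\<in>{1..?t}. sign_normalizer d * form_pq (w (h j)) (u (h j) (d - 1)) = 1} = positive_parts d"
      by (auto simp: positive_parts_def)
  qed auto
  then have pc: "plus_count X d (w \<circ> h) = card (positive_parts d)"
    unfolding plus_count_eq using bij_betw_same_card by fastforce
  then show "\<exists>H Y v. su_sl2_triple X H Y \<and> adapted_basis X H Y d v \<and> card (positive_parts d) = plus_count X d v"
    using ad triple[OF assms(2)] by metis
  fix a assume "\<exists>H Y v. su_sl2_triple X H Y \<and> adapted_basis X H Y d v \<and> a = plus_count X d v"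
  then obtain H' Y' v where "adapted_basis X H' Y' d v" "a = plus_count X d v" by blast
  then show "a = card (positive_parts d)"
    using plus_count_le[OF assms(1) ad] plus_count_le[OF assms(1) _ ad] pc by (metis antisym)
qed

lemma parts_of_size_gram:
  assumes "d > 0" "j \<in> parts_of_size d" "k \<in> parts_of_size d"
  shows "form_pq (w j) (u k (d - 1)) = (if j = k then form_pq (w j) (u j (d - 1)) else 0)"
  using assms gram[of j k 0 "d - 1"] by (auto simp: parts_of_size_def)

lemma negative_parts_sign:
  assumes "j \<in> parts_of_size d - positive_parts d"
  shows "sign_normalizer d * form_pq (w j) (u j (d - 1)) = -1"
  using assms sign_normalizer_unit_signs[of _ d] gram_sign[of j]
  by (auto simp: positive_parts_def parts_of_size_def)

text \<open>Conjugation of \<open>X\<close> to \<open>- X\<close> negates the form \<open>\<langle>x, X\<^sup>d\<^sup>-\<^sup>1 y\<rangle>\<close> for even \<open>d\<close>, so it turns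
  a positive family into a negative one and vice versa; the signature bound then applies twice.\<close>

lemma real_imp_balanced:
  assumes g: "g ** X = - (X ** g)" "\<And>x y. form_pq (g *v x) (g *v y) = form_pq x y"
    and d: "even d" "d > 0"
  shows "2 * card (positive_parts d) = count (jordan_partition X) d"
proof -
  let ?t = "count (jordan_partition X) d"
  let ?P = "positive_parts d" and ?N = "parts_of_size d - positive_parts d"
  have ker: "matrix_pow X d *v w j = 0" if "j \<in> parts_of_size d" for j
    using that u_eq_0[of j d] by (auto simp: parts_of_size_def)
  then have gker: "matrix_pow X d *v (g *v w j) = 0" if "j \<in> parts_of_size d" for j
    using that by (simp add: anticommuting_matrix_pow[OF g(1)])
  have gform: "form_pq (g *v w j) (matrix_pow X (d - 1) *v (g *v w k)) = - form_pq (w j) (u k (d - 1))" for j k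
    using d by (simp add: anticommuting_matrix_pow[OF g(1)] form_pq_minus_right g(2))
  have fin: "finite ?P" "finite ?N" using finite_subset[OF positive_parts_subset] by auto
  have P: "sign_normalizer d * form_pq (w j) (u j (d - 1)) = 1" if "j \<in> ?P" for j
    using that by (simp add: positive_parts_def)
  have gramP: "sign_normalizer d * form_pq (w j) (u k (d - 1)) = (if j = k then 1 else 0)"
    if "j \<in> ?P" "k \<in> ?P" for j k
    unfolding parts_of_size_gram[OF d(2) subsetD[OF positive_parts_subset that(1)] subsetD[OF positive_parts_subset that(2)]]
    using P[OF that(1)] by (auto simp del: One_nat_def)
  have gramN: "sign_normalizer d * form_pq (w j) (u k (d - 1)) = (if j = k then -1 else 0)"
    if "j \<in> ?N" "k \<in> ?N" for j k
    unfolding parts_of_size_gram[OF d(2) DiffD1[OF that(1)] DiffD1[OF that(2)]]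
    using negative_parts_sign[OF that(1)] by (auto simp del: One_nat_def)
  have "card ?P + card ?P \<le> ?t"
  proof (rule signature_bound[OF d(2) fin(1) fin(1), where s = "sign_normalizer d" and x = w and y = "\<lambda>j. g *v w j"])
    fix j k assume jk: "j \<in> ?P" "k \<in> ?P"
    show "matrix_pow X d *v w j = 0" "matrix_pow X d *v (g *v w j) = 0"
      using jk ker gker positive_parts_subset by blast+
    show "sign_normalizer d * form_pq (w j) (u k (d - 1)) = (if j = k then 1 else 0)"
      by (rule gramP[OF jk])
    show "sign_normalizer d * form_pq (g *v w j) (matrix_pow X (d - 1) *v (g *v w k)) = (if j = k then -1 else 0)"
      unfolding gform using gramP[OF jk] by (simp split: if_splits)
  qed
  moreover have "card ?N + card ?N \<le> ?t"
  proof (rule signature_bound[OF d(2) fin(2) fin(2), where s = "sign_normalizer d" and x = "\<lambda>j. g *v w j" and y = w])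
    fix j k assume jk: "j \<in> ?N" "k \<in> ?N"
    show "matrix_pow X d *v w j = 0" "matrix_pow X d *v (g *v w j) = 0"
      using jk ker gker by blast+
    show "sign_normalizer d * form_pq (w j) (u k (d - 1)) = (if j = k then -1 else 0)"
      by (rule gramN[OF jk])
    show "sign_normalizer d * form_pq (g *v w j) (matrix_pow X (d - 1) *v (g *v w k)) = (if j = k then 1 else 0)"
      unfolding gform using gramN[OF jk] by (simp split: if_splits)
  qed
  moreover have "card ?P + card ?N = ?t"
    using card_Diff_subset[OF fin(1) positive_parts_subset] card_mono[OF _ positive_parts_subset, of d]
    by (simp add: card_parts_of_size)
  ultimately show ?thesis by linarith
qed

section \<open>Construction of the involution\<close>

lemma balanced_imp_swapping:
  assumes "\<And>d. d \<in> set ds \<Longrightarrow> even d \<Longrightarrow> 2 * card (positive_parts d) = count (jordan_partition X) d"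
  shows "\<exists>\<pi>. \<forall>j<length ds. \<pi> j < length ds \<and> ds ! \<pi> j = ds ! j \<and> \<pi> (\<pi> j) = j \<and> (odd (ds ! j) \<longrightarrow> \<pi> j = j) \<and>
     (even (ds ! j) \<longrightarrow> form_pq (w (\<pi> j)) (u (\<pi> j) (ds ! j - 1)) = - form_pq (w j) (u j (ds ! j - 1)))"
proof -
  have "\<exists>\<pi>. (\<forall>j\<in>positive_parts d. \<pi> j \<in> parts_of_size d - positive_parts d \<and> \<pi> (\<pi> j) = j) \<and>
     (\<forall>j\<in>parts_of_size d - positive_parts d. \<pi> j \<in> positive_parts d \<and> \<pi> (\<pi> j) = j)"
    if "d \<in> set ds" "even d" for d
  proof (rule involution_swapping)
    have fin: "finite (positive_parts d)" using finite_subset[OF positive_parts_subset] by auto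
    then show "finite (positive_parts d)" .
    show "card (positive_parts d) = card (parts_of_size d - positive_parts d)"
      using card_Diff_subset[OF fin positive_parts_subset] assms[OF that] by (simp add: card_parts_of_size)
  qed auto
  then obtain \<sigma> where \<sigma>: "\<And>d j. d \<in> set ds \<Longrightarrow> even d \<Longrightarrow> j \<in> positive_parts d \<Longrightarrow>
      \<sigma> d j \<in> parts_of_size d - positive_parts d \<and> \<sigma> d (\<sigma> d j) = j"
    "\<And>d j. d \<in> set ds \<Longrightarrow> even d \<Longrightarrow> j \<in> parts_of_size d - positive_parts d \<Longrightarrow>
      \<sigma> d j \<in> positive_parts d \<and> \<sigma> d (\<sigma> d j) = j"
    by metis
  define \<pi> where "\<pi> = (\<lambda>j. if even (ds ! j) then \<sigma> (ds ! j) j else j)"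
  have even_case: "\<pi> j < length ds \<and> ds ! \<pi> j = ds ! j \<and> \<pi> (\<pi> j) = j \<and>
     form_pq (w (\<pi> j)) (u (\<pi> j) (ds ! j - 1)) = - form_pq (w j) (u j (ds ! j - 1))"
    if j: "j < length ds" "even (ds ! j)" for j
  proof -
    define d where "d = ds ! j"
    have d: "d \<in> set ds" "even d" "j \<in> parts_of_size d" using j by (auto simp: d_def parts_of_size_def)
    have P: "sign_normalizer d * form_pq (w j) (u j (d - 1)) = 1" if "j \<in> positive_parts d" for j
      using that by (simp add: positive_parts_def)
    have s0: "sign_normalizer d \<noteq> 0" by (simp add: sign_normalizer_def)
    have \<sigma>d: "\<sigma> d j \<in> parts_of_size d" "\<sigma> d (\<sigma> d j) = j"
      "sign_normalizer d * form_pq (w (\<sigma> d j)) (u (\<sigma> d j) (d - 1)) =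
       sign_normalizer d * (- form_pq (w j) (u j (d - 1)))"
      using \<sigma>[OF d(1,2), of j] d(3) positive_parts_subset P negative_parts_sign
      by (cases "j \<in> positive_parts d"; force)+
    then have "ds ! \<sigma> d j = d" by (simp add: parts_of_size_def)
    moreover have "form_pq (w (\<sigma> d j)) (u (\<sigma> d j) (d - 1)) = - form_pq (w j) (u j (d - 1))"
      using \<sigma>d(3) s0 by (simp only: mult_cancel_left simp_thms)
    ultimately show ?thesis using \<sigma>d(1,2) d(2) unfolding \<pi>_def d_def[symmetric]
      by (simp add: parts_of_size_def)
  qed
  show ?thesis
  proof (intro exI[of _ \<pi>] allI impI)
    fix j assume j: "j < length ds"
    show "\<pi> j < length ds \<and> ds ! \<pi> j = ds ! j \<and> \<pi> (\<pi> j) = j \<and> (odd (ds ! j) \<longrightarrow> \<pi> j = j) \<and>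
      (even (ds ! j) \<longrightarrow> form_pq (w (\<pi> j)) (u (\<pi> j) (ds ! j - 1)) = - form_pq (w j) (u j (ds ! j - 1)))"
    proof (cases "even (ds ! j)")
      case True
      then show ?thesis using even_case[OF j True] by simp
    qed (use j in \<open>simp add: \<pi>_def\<close>)
  qed
qed

text \<open>On a pair with i + l + 1 = d the alternating signs contribute (-1)^(d - 1). For odd d
  this is 1 and the chain stays in place; for even d it is -1, which the change of sign under
  \<open>\<pi>\<close> compensates.\<close>

lemma swapping_imp_strongly_real:
  assumes \<pi>: "\<And>j. j < length ds \<Longrightarrow> \<pi> j < length ds" "\<And>j. j < length ds \<Longrightarrow> ds ! \<pi> j = ds ! j"
      "\<And>j. j < length ds \<Longrightarrow> \<pi> (\<pi> j) = j" "\<And>j. j < length ds \<Longrightarrow> odd (ds ! j) \<Longrightarrow> \<pi> j = j"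
    and \<pi>_form: "\<And>j. j < length ds \<Longrightarrow> even (ds ! j) \<Longrightarrow>
       form_pq (w (\<pi> j)) (u (\<pi> j) (ds ! j - 1)) = - form_pq (w j) (u j (ds ! j - 1))"
  shows "strongly_Ad_real SU_pq X"
proof -
  \<comment> \<open>On a chain of odd length d the alternating signs have product (-1)^(d div 2),
    and \<open>\<epsilon> j\<close> enters the determinant as its d-th power, which is
    \<open>\<epsilon> j\<close> itself.\<close>
  define \<epsilon> :: "nat \<Rightarrow> complex" where "\<epsilon> = (\<lambda>j. if odd (ds ! j) then (-1) ^ (ds ! j div 2) else 1)"
  have \<epsilon>2: "\<epsilon> j * \<epsilon> j = 1" for j by (simp add: \<epsilon>_def flip: power_add)
  have \<epsilon>\<pi>: "\<epsilon> (\<pi> j) = \<epsilon> j" if "j < length ds" for j using \<pi>(2)[OF that] by (simp add: \<epsilon>_def)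
  have \<epsilon>cnj: "cnj (\<epsilon> j) = \<epsilon> j" for j by (simp add: \<epsilon>_def)
  define c where "c = (\<lambda>(j, i). (-1) ^ i * \<epsilon> j)"
  obtain T :: "complex^('p + 'q)^('p + 'q)" where
    T0: "\<And>k. k \<in> J \<Longrightarrow> T *v (case k of (j, i) \<Rightarrow> u j i) = (case k of (j, i) \<Rightarrow> c (j, i) *s u (\<pi> j) i)"
    using obtain_matrix_on_basis[OF basis_independent] by blast
  \<comment> \<open>The formula is extended past the end of the chain, where both sides vanish; this
    lets \<open>TX\<close> treat the last vector of a chain like the others.\<close>
  have T: "T *v u j i = c (j, i) *s u (\<pi> j) i" if "j < length ds" for j i
    using T0[of "(j, i)"] that u_eq_0[of j i] u_eq_0[of "\<pi> j" i] \<pi> by (cases "i < ds ! j") auto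
  have TT: "T ** T = mat 1"
  proof (rule matrix_eq_on_spanning[OF spanning])
    fix x assume "x \<in> chain_vectors X ds w"
    then obtain j i where ji: "j < length ds" "x = u j i" by (auto simp: chain_vectors_def)
    have "T *v (T *v u j i) = (c (j, i) * c (\<pi> j, i)) *s u j i"
      using ji \<pi> by (simp add: T vec.scale)
    also have "c (j, i) * c (\<pi> j, i) = ((-1) ^ i * (-1) ^ i) * (\<epsilon> j * \<epsilon> j)"
      using \<epsilon>\<pi>[OF ji(1)] by (simp add: c_def mult_ac)
    also have "\<dots> = 1" by (simp add: \<epsilon>2 flip: power_add)
    finally show "(T ** T) *v x = mat 1 *v x" using ji by (simp flip: matrix_vector_mul_assoc)
  qed
  have TX: "T ** X = - (X ** T)"
  proof (rule matrix_eq_on_spanning[OF spanning])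
    fix x assume "x \<in> chain_vectors X ds w"
    then obtain j i where ji: "j < length ds" "x = u j i" by (auto simp: chain_vectors_def)
    have X_u: "X *v u j i = u j (Suc i)" for j i by (simp add: matrix_pow_Suc_vec)
    show "(T ** X) *v x = (- (X ** T)) *v x"
      using ji by (simp add: minus_matrix_vector_mult X_u T c_def vec.scale flip: matrix_vector_mul_assoc)
  qed
  have Tform: "form_pq (T *v x) (T *v y) = form_pq x y" for x y
  proof -
    have "form_pq (T *v x) (T *v y) = 1 * form_pq (mat 1 *v x) (mat 1 *v y)"
    proof (rule form_pq_eq_on_spanning[OF spanning])
      fix x y assume "x \<in> chain_vectors X ds w" "y \<in> chain_vectors X ds w"
      then obtain j i k l where ji: "j < length ds" "x = u j i" and kl: "k < length ds" "y = u k l"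
        by (auto simp: chain_vectors_def)
      have inj: "\<pi> j = \<pi> k \<longleftrightarrow> j = k" using \<pi>(3)[OF ji(1)] \<pi>(3)[OF kl(1)] by metis
      have e: "form_pq (T *v x) (T *v y) = ((-1) ^ (i + l) * (\<epsilon> j * \<epsilon> k)) * form_pq (u (\<pi> j) i) (u (\<pi> k) l)"
        using ji kl by (simp add: T c_def form_pq_scale_left form_pq_scale_right \<epsilon>cnj power_add mult_ac)
      show "form_pq (T *v x) (T *v y) = 1 * form_pq (mat 1 *v x) (mat 1 *v y)"
      proof (cases "j = k \<and> Suc (i + l) = ds ! j")
        case False
        then have "form_pq (u (\<pi> j) i) (u (\<pi> k) l) = 0" "form_pq (u j i) (u k l) = 0"
          using ji kl \<pi> inj by (auto simp: gram)
        then show ?thesis unfolding e using ji kl by simp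
      next
        case True
        then have il: "ds ! j = Suc (i + l)" and jk: "k = j" by auto
        have 1: "form_pq (u (\<pi> j) i) (u (\<pi> j) l) = (-1) ^ i * form_pq (w (\<pi> j)) (u (\<pi> j) (ds ! j - 1))"
          using gram[of "\<pi> j" "\<pi> j" i l] \<pi> ji il by simp
        have 2: "form_pq (u j i) (u j l) = (-1) ^ i * form_pq (w j) (u j (ds ! j - 1))"
          using gram[of j j i l] ji il by simp
        have "(-1) ^ (i + l) * form_pq (w (\<pi> j)) (u (\<pi> j) (ds ! j - 1)) = form_pq (w j) (u j (ds ! j - 1))"
        proof (cases "even (ds ! j)")
          case True
          then show ?thesis using \<pi>_form[OF ji(1) True] il by simp
        next
          case False
          then show ?thesis using \<pi>(4)[OF ji(1) False] il by simp
        qed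
        then show ?thesis unfolding e jk using ji kl jk 1 2 \<epsilon>2 by simp
      qed
    qed
    then show ?thesis by simp
  qed
  have detT: "det T = 1"
  proof -
    text \<open>\<open>\<rho>\<close> runs through the pair of chains \<open>j\<close>, \<open>\<pi> j\<close> of even length in 4-cycles, and
      \<open>\<rho> \<circ> \<rho>\<close> is the permutation of the basis underlying \<open>T\<close>.\<close>
    define \<rho> where "\<rho> = (\<lambda>(j, i). if odd (ds ! j) then (j, i)
        else if even i then (j, Suc i) else (\<pi> j, i - 1))"
    have \<rho>J: "\<rho> k \<in> J" if "k \<in> J" for k
    proof -
      obtain j i where k: "k = (j, i)" by force
      then have ji: "j < length ds" "i < ds ! j" using that by auto
      have "Suc i < ds ! j" if "even (ds ! j)" "even i"
        using ji that by (metis Suc_lessI even_Suc)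
      then show ?thesis using ji \<pi> by (auto simp: k \<rho>_def)
    qed
    have \<rho>\<rho>: "\<rho> (\<rho> (j, i)) = (\<pi> j, i)" if "(j, i) \<in> J" for j i
      using that \<pi> by (auto simp: \<rho>_def)
    have \<rho>4: "\<rho> (\<rho> (\<rho> (\<rho> k))) = k" if "k \<in> J" for k
      using that \<rho>\<rho> \<pi> by (cases k) simp
    have bij: "bij_betw \<rho> J J"
    proof (rule bij_betw_byWitness[where f' = "\<rho> \<circ> \<rho> \<circ> \<rho>"])
      show "(\<rho> \<circ> \<rho> \<circ> \<rho>) ` J \<subseteq> J"
        by (intro image_subsetI) (simp only: o_apply, intro \<rho>J)
      show "\<rho> ` J \<subseteq> J" by (intro image_subsetI \<rho>J)
      show "\<forall>k\<in>J. (\<rho> \<circ> \<rho> \<circ> \<rho>) (\<rho> k) = k" "\<forall>k\<in>J. \<rho> ((\<rho> \<circ> \<rho> \<circ> \<rho>) k) = k"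
        by (intro ballI, simp only: o_apply \<rho>4)+
    qed
    have "det T = (\<Prod>k\<in>J. c k)"
    proof (rule det_monomial[OF basis_independent _ _ bij])
      show "vec.span ((\<lambda>(j, i). u j i) ` J) = UNIV" using spanning by (simp add: chain_vectors_def)
      fix k assume "k \<in> J"
      then show "T *v (case k of (j, i) \<Rightarrow> u j i) = c k *s (case \<rho> (\<rho> k) of (j, i) \<Rightarrow> u j i)"
        using \<rho>\<rho> by (cases k) (simp add: T)
    qed
    also have "J = (SIGMA j:{..<length ds}. {..<ds ! j})" by auto
    also have "(\<Prod>k\<in>\<dots>. c k) = (\<Prod>j<length ds. \<Prod>i<ds ! j. c (j, i))"
      by (subst prod.Sigma) (auto simp: case_prod_unfold)
    also have "\<dots> = (\<Prod>j<length ds. if even (ds ! j) then (-1) ^ (ds ! j div 2) else 1)"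
    proof (rule prod.cong)
      fix j assume "j \<in> {..<length ds}"
      have "(\<Prod>i<ds ! j. c (j, i)) = (-1) ^ (ds ! j div 2) * \<epsilon> j ^ (ds ! j)"
        by (simp add: c_def prod.distrib prod_alternating)
      also have "\<dots> = (if even (ds ! j) then (-1) ^ (ds ! j div 2) else 1)"
      proof (cases "even (ds ! j)")
        case False
        then obtain m where m: "ds ! j = Suc (2 * m)" by (auto elim: oddE)
        have "\<epsilon> j ^ (ds ! j) = \<epsilon> j" unfolding m by (simp add: power_mult power2_eq_square \<epsilon>2)
        then show ?thesis using False by (simp add: \<epsilon>_def flip: power_add)
      qed (simp add: \<epsilon>_def)
      finally show "(\<Prod>i<ds ! j. c (j, i)) = (if even (ds ! j) then (-1) ^ (ds ! j div 2) else 1)" .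
    qed simp
    also have "\<dots> = (\<Prod>j\<in>{j\<in>{..<length ds}. even (ds ! j)}. (-1) ^ (ds ! j div 2))"
      by (rule prod.inter_filter[symmetric]) simp
    also have "\<dots> = 1"
    proof -
      let ?E = "{j\<in>{..<length ds}. even (ds ! j)}"
      let ?f = "\<lambda>j. (-1 :: complex) ^ (ds ! j div 2)"
      \<comment> \<open>\<open>P\<close> selects one chain from each swapped pair, the one with
        value i. Both members have the same length, so every factor occurs squared.\<close>
      define P where "P = {j \<in> ?E. form_pq (w j) (u j (ds ! j - 1)) = \<i>}"
      have inE: "form_pq (w j) (u j (ds ! j - 1)) \<in> {\<i>, -\<i>}" if "j \<in> ?E" for j
        using gram_sign[of j] that by (auto simp: unit_signs_def)
      have \<pi>E: "\<pi> j \<in> ?E" if "j \<in> ?E" for j using that \<pi> by auto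
      have swap: "\<pi> j \<in> ?E - P \<longleftrightarrow> j \<in> P" if "j \<in> ?E" for j
        using \<pi>_form[of j] inE[OF that] inE[OF \<pi>E[OF that]] \<pi>E[OF that] that \<pi>(2)[of j]
        by (auto simp: P_def complex_eq_iff)
      have bij: "bij_betw \<pi> P (?E - P)"
      proof (rule bij_betw_byWitness[where f' = \<pi>])
        show "\<pi> ` P \<subseteq> ?E - P" using swap by (auto simp: P_def)
        show "\<pi> ` (?E - P) \<subseteq> P"
        proof (rule image_subsetI)
          fix j assume "j \<in> ?E - P"
          then have j: "j \<in> ?E" "j \<notin> P" by blast+
          from j have "\<pi> (\<pi> j) \<in> ?E - P" using \<pi>(3) by auto
          then show "\<pi> j \<in> P" using swap[OF \<pi>E[OF j(1)]] by blast
        qed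
      qed (use \<pi> in \<open>auto simp: P_def\<close>)
      have "(\<Prod>j\<in>?E. ?f j) = (\<Prod>j\<in>?E - P. ?f j) * (\<Prod>j\<in>P. ?f j)"
        by (rule prod.subset_diff) (auto simp: P_def)
      also have "(\<Prod>j\<in>?E - P. ?f j) = (\<Prod>j\<in>P. ?f (\<pi> j))"
        by (rule prod.reindex_bij_betw[OF bij, symmetric])
      also have "\<dots> = (\<Prod>j\<in>P. ?f j)"
        by (rule prod.cong) (use \<pi>(2) in \<open>auto simp: P_def\<close>)
      also have "\<dots> * (\<Prod>j\<in>P. ?f j) = (\<Prod>j\<in>P. ?f j * ?f j)" by (rule prod.distrib[symmetric])
      also have "\<dots> = 1" by (simp flip: power_add)
      finally show ?thesis .
    qed
    finally show ?thesis .
  qed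
  have "T \<in> SU_pq" using detT Tform by (simp add: SU_pq_iff)
  moreover have "- X = Ad T X" using Ad_eq_minus_iff[of T X] detT TX by simp
  ultimately show ?thesis using TT unfolding strongly_Ad_real_def by blast
qed

end

theorem theorem5p5:
  fixes X :: "complex^('p::finite + 'q::finite)^('p + 'q)"
  assumes "X \<in> su_pq" and "X \<noteq> 0" and "nilpotent_matrix X"
  shows "(Ad_real SU_pq X \<longleftrightarrow> strongly_Ad_real SU_pq X) \<and>
         (strongly_Ad_real SU_pq X \<longleftrightarrow>
           (\<forall>\<eta>\<in>even_parts X.
              real (p_mult X \<eta>) = real (count (jordan_partition X) \<eta>) / 2 \<and>
              real (q_mult X \<eta>) = real (count (jordan_partition X) \<eta>) / 2))"
proof -
  have tr: "trace X = 0" and skew: "skew_pq X"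
    using assms(1) by (auto simp: su_pq_iff skew_pq_def)
  obtain ds w where "orthogonal_chain_basis X ds w"
    using orthogonal_chain_basis_exists[OF skew assms(3)] by blast
  then interpret orthogonal_chain_basis X ds w .
  let ?balanced = "\<forall>\<eta>\<in>even_parts X.
              real (p_mult X \<eta>) = real (count (jordan_partition X) \<eta>) / 2 \<and>
              real (q_mult X \<eta>) = real (count (jordan_partition X) \<eta>) / 2"
  have even_parts: "even_parts X = {d \<in> set ds. even d}"
    by (simp add: even_parts_def partition_eq)
  have pos: "d > 0" if "d \<in> set ds" for d
    using that part_pos by (auto simp: in_set_conv_nth)
  have balanced: "?balanced \<longleftrightarrow>
      (\<forall>d\<in>set ds. even d \<longrightarrow> 2 * card (positive_parts d) = count (jordan_partition X) d)"
    unfolding even_parts q_mult_def by (auto simp: p_mult_eq[OF pos tr])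
  have "strongly_Ad_real SU_pq X \<Longrightarrow> Ad_real SU_pq X"
    by (auto simp: strongly_Ad_real_def Ad_real_def)
  moreover have "?balanced" if real: "Ad_real SU_pq X"
  proof -
    obtain g where g: "g \<in> SU_pq" "- X = Ad g X" using real unfolding Ad_real_def by blast
    then have "g ** X = - (X ** g)" using Ad_eq_minus_iff[of g X] by (simp add: SU_pq_iff)
    then show ?thesis unfolding balanced using real_imp_balanced g(1) pos SU_pq_iff by blast
  qed
  moreover have "strongly_Ad_real SU_pq X" if "?balanced"
  proof -
    have "2 * card (positive_parts d) = count (jordan_partition X) d" if "d \<in> set ds" "even d" for d
      using \<open>?balanced\<close> that unfolding balanced by blast
    from balanced_imp_swapping[OF this] obtain \<pi> where
      "\<forall>j<length ds. \<pi> j < length ds \<and> ds ! \<pi> j = ds ! j \<and> \<pi> (\<pi> j) = j \<and> (odd (ds ! j) \<longrightarrow> \<pi> j = j) \<and>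
     (even (ds ! j) \<longrightarrow> form_pq (w (\<pi> j)) (u (\<pi> j) (ds ! j - 1)) = - form_pq (w j) (u j (ds ! j - 1)))"
      by blast
    then show ?thesis using swapping_imp_strongly_real[of \<pi>] by blast
  qed
  ultimately show ?thesis by blast
qed

end
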